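(* Let $q\in(0,1)$ be a constant and let $t,t'$ be two traces produced by the deletion channel with retention probability $q$ (each bit deleted independently with probability $1-q$), where either (Case 1) $t,t'$ are independent traces of the same uniformly random string $x\in\{0,1\}^{\sqrt n}$, or (Case 2) $t,t'$ are traces of two independent uniformly random strings $x,y\in\{0,1\}^{\sqrt n}$. Let $w=100n^{1/4}\sqrt{(1/q)\log n}$, and for $i\ge 0$ let $S_i=\{2wi+j: j=0,\dots,w-1\}$, $X_i=\sum_{j\in S_i}t_j$, $Y_i=\sum_{j\in S_i}t'_j$, $Z_i=(X_i-Y_i)^2$ (traces indexed from position $0$). Let $g=96/q^2$, $z_j=\sum_{i=0}^{g-1}Z_{jg+i}$, and $D=\mathrm{median}(z_0,z_1,\dots,z_N)$ with $N=\Theta(\log n)$. Then for $n$ sufficiently large: in Case 1, $\Pr[D<(1-q/4)gw/2]\ge 1-1/n^{10}$; in Case 2, $\Pr[D\ge(1-q/4)gw/2]\ge 1-1/n^{10}$.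
   Context: The deletion channel with retention probability $q$ deletes each coordinate of its input independently with probability $1-q$ and outputs the subsequence of surviving coordinates (deletion locations unknown). Probabilities are over the randomness of the strings and the channel. *)

theory Defs
  imports "HOL-Probability.Probability" "HOL-Library.Landau_Symbols"
begin

definition deletion_channel :: "real \<Rightarrow> 'a list \<Rightarrow> 'a list pmf" where
  "deletion_channel q x =
     map_pmf (\<lambda>keep. nths x {i. keep i})
       (Pi_pmf {..<length x} False (\<lambda>_. bernoulli_pmf q))"

definition random_string :: "nat \<Rightarrow> bool list pmf" where
  "random_string m = pmf_of_set {x. length x = m}"

(* The two traces are independent conditionally on their common source string. *)
definition traces_same_source :: "real \<Rightarrow> nat \<Rightarrow> (bool list \<times> bool list) pmf" where
  "traces_same_source q m =
     bind_pmf (random_string m)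
       (\<lambda>x. pair_pmf (deletion_channel q x) (deletion_channel q x))"

definition traces_indep_sources :: "real \<Rightarrow> nat \<Rightarrow> (bool list \<times> bool list) pmf" where
  "traces_indep_sources q m =
     bind_pmf (pair_pmf (random_string m) (random_string m))
       (\<lambda>(x, y). pair_pmf (deletion_channel q x) (deletion_channel q y))"

(* Traces have random length; positions beyond the end of a trace are read as 0. *)
definition bit_at :: "bool list \<Rightarrow> nat \<Rightarrow> real" where
  "bit_at t j = (if j < length t then of_bool (t ! j) else 0)"

(* The real-valued parameters sqrt n, w and g are rounded to integers:
   the string length down, the window width and the group size up. *)
definition string_length :: "nat \<Rightarrow> nat" where
  "string_length n = nat \<lfloor>sqrt (real n)\<rfloor>"

definition window_width :: "real \<Rightarrow> nat \<Rightarrow> nat" where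
  "window_width q n =
     nat \<lceil>100 * real n powr (1/4) * sqrt ((1/q) * ln (real n))\<rceil>"

definition group_size :: "real \<Rightarrow> nat" where
  "group_size q = nat \<lceil>96 / q^2\<rceil>"

definition S :: "nat \<Rightarrow> nat \<Rightarrow> nat set" where
  "S w i = {2 * w * i + j | j. j < w}"

definition window_sum :: "nat \<Rightarrow> bool list \<Rightarrow> nat \<Rightarrow> real" where
  "window_sum w t i = (\<Sum>j\<in>S w i. bit_at t j)"

definition Z :: "nat \<Rightarrow> bool list \<Rightarrow> bool list \<Rightarrow> nat \<Rightarrow> real" where
  "Z w t t' i = (window_sum w t i - window_sum w t' i)^2"

definition group_sum :: "nat \<Rightarrow> nat \<Rightarrow> bool list \<Rightarrow> bool list \<Rightarrow> nat \<Rightarrow> real" where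
  "group_sum w g t t' j = (\<Sum>i<g. Z w t t' (j * g + i))"

(* For a list of even length this is the mean of the two middle elements;
   for odd length the two indices coincide. *)
definition median :: "real list \<Rightarrow> real" where
  "median xs = (sort xs ! ((length xs - 1) div 2) + sort xs ! (length xs div 2)) / 2"

definition D :: "nat \<Rightarrow> nat \<Rightarrow> nat \<Rightarrow> bool list \<Rightarrow> bool list \<Rightarrow> real" where
  "D w g N t t' = median (map (group_sum w g t t') [0..<Suc N])"

end

(* Condition on the two sets of surviving positions. With probability at least 1 - O(M) n^(-13)
   the rank functions of both sets and of their intersection stay within q w / 10 of the lines of
   slope q, q and q^2 on the first M = O(w log n) positions, which are the only ones that the
   windows read (Hoeffding; the deviation q w / 10 is far above sqrt M because only O(log n)
   windows occur). Then windows with different indices read disjoint source bits, and, in Case 1,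
   the two i-th windows share at least q w / 2 of their source bits.

   Given the survivors, X_i - Y_i is half a sum of k_i = 2 (w - overlap) independent random signs,
   so Z_i has mean k_i / 4 and variance at most k_i^2 / 8 <= w^2 / 2, and the Z_i are independent.
   In both cases the threshold lies at least q g w / 8 away from the mean of a group sum, so by
   Chebyshev and g >= 96 / q^2 a group sum lands on the wrong side with probability at most 1/3.
   The median is wrong only if half of the independent group sums are, which by Hoeffding has
   probability at most exp (-(N + 1) / 18). *)
theory Submission
  imports Defs "HOL-Real_Asymp.Real_Asymp"
begin

section \<open>Medians\<close>

lemma length_filter_sort: "length (filter P (sort xs)) = length (filter P xs)"
  by (metis mset_filter mset_sort size_mset)

text \<open>Both indices averaged by \<open>median\<close> are at least
  \<open>(L - 1) div 2\<close>, so an entry below \<open>\<theta>\<close> at either of them would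
  put at least half of the sorted list below \<open>\<theta>\<close>.\<close>

lemma median_ge:
  assumes "2 * length (filter (\<lambda>x. x < \<theta>) xs) < length xs"
  shows "\<theta> \<le> median xs"
proof -
  define ys where "ys = sort xs"
  define L where "L = length xs"
  have L: "length ys = L" "0 < L" and [simp]: "sorted ys"
    using assms by (auto simp: ys_def L_def)
  have ge: "\<theta> \<le> ys ! k" if k: "k < L" "(L - 1) div 2 \<le> k" for k
  proof (rule ccontr)
    assume "\<not> \<theta> \<le> ys ! k"
    then have "ys ! i < \<theta>" if "i \<le> k" for i
      using sorted_nth_mono[of ys i k] k L that by auto
    then have "{..k} \<subseteq> {i. i < length ys \<and> ys ! i < \<theta>}"
      using k L by auto
    then have "card {..k} \<le> length (filter (\<lambda>x. x < \<theta>) ys)"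
      unfolding length_filter_conv_card by (intro card_mono) auto
    also have "\<dots> = length (filter (\<lambda>x. x < \<theta>) xs)"
      unfolding ys_def by (rule length_filter_sort)
    finally show False using assms k L_def by simp
  qed
  show ?thesis
    using ge[of "(L - 1) div 2"] ge[of "L div 2"] L div_le_mono[of "L - 1" L 2]
    by (simp add: median_def less_mult_imp_div_less flip: ys_def L_def)
qed

text \<open>Dually, both indices are at most \<open>L div 2\<close>, so a middle entry at or above
  \<open>\<theta>\<close> leaves at least half of the sorted list at or above it.\<close>

lemma median_less:
  assumes "2 * length (filter (\<lambda>x. \<theta> \<le> x) xs) < length xs"
  shows "median xs < \<theta>"
proof -
  define ys where "ys = sort xs"
  define L where "L = length xs"
  have L: "length ys = L" "0 < L" and [simp]: "sorted ys"
    using assms by (auto simp: ys_def L_def)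
  have less: "ys ! k < \<theta>" if k: "k \<le> L div 2" for k
  proof (rule ccontr)
    assume "\<not> ys ! k < \<theta>"
    then have "\<theta> \<le> ys ! i" if "k \<le> i" "i < L" for i
      using sorted_nth_mono[of ys k i] k L that by auto
    then have "{k..<L} \<subseteq> {i. i < length ys \<and> \<theta> \<le> ys ! i}"
      using k L by auto
    then have "card {k..<L} \<le> length (filter (\<lambda>x. \<theta> \<le> x) ys)"
      unfolding length_filter_conv_card by (intro card_mono) auto
    also have "\<dots> = length (filter (\<lambda>x. \<theta> \<le> x) xs)"
      unfolding ys_def by (rule length_filter_sort)
    finally show False using assms k L_def by simp
  qed
  show ?thesis
    using less[of "(L - 1) div 2"] less[of "L div 2"] L
    by (simp add: median_def div_le_mono flip: ys_def L_def)
qed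

section \<open>Source positions of a window\<close>

text \<open>For \<open>p\<close> in the survivor set \<open>A\<close> this is the index, counted
  from 0, at which the source bit \<open>p\<close> appears in the trace.\<close>

definition rank :: "nat set \<Rightarrow> nat \<Rightarrow> nat" where
  "rank A p = card (A \<inter> {..<p})"

text \<open>The source positions whose bits the \<open>i\<close>-th window of the trace
  reads.\<close>

definition window_positions :: "nat \<Rightarrow> nat set \<Rightarrow> nat \<Rightarrow> nat set" where
  "window_positions w A i = {p \<in> A. rank A p \<in> S w i}"

lemma S_eq: "S w i = {2 * w * i..<2 * w * i + w}"
proof (rule set_eqI)
  fix x
  show "x \<in> S w i \<longleftrightarrow> x \<in> {2 * w * i..<2 * w * i + w}"
    unfolding S_def by (auto intro: exI[of _ "x - 2 * w * i"])
qed

lemma rank_mono: "p \<le> p' \<Longrightarrow> rank A p \<le> rank A p'"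
  unfolding rank_def by (intro card_mono) auto

text \<open>Change of variables from trace indices to source positions. Appending a last element
  leaves the ranks of all earlier positions alone, hence the induction from the right.\<close>

lemma sum_nths:
  fixes G :: "nat \<Rightarrow> 'a \<Rightarrow> 'b::comm_monoid_add"
  shows "(\<Sum>j<length (nths xs A). G j (nths xs A ! j)) =
    (\<Sum>p\<in>A \<inter> {..<length xs}. G (rank A p) (xs ! p))"
proof (induction xs rule: rev_induct)
  case (snoc x xs)
  let ?n = "length xs"
  have len: "length (nths xs A) = rank A ?n"
    by (simp add: length_nths rank_def Int_def conj_commute)
  have old: "(\<Sum>p\<in>A \<inter> {..<?n}. G (rank A p) ((xs @ [x]) ! p)) =
      (\<Sum>p\<in>A \<inter> {..<?n}. G (rank A p) (xs ! p))"
    by (intro sum.cong) (auto simp: nth_append)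
  have old': "(\<Sum>j<rank A ?n. G j ((nths xs A @ [x]) ! j)) =
      (\<Sum>j<rank A ?n. G j (nths xs A ! j))"
    by (intro sum.cong) (auto simp: nth_append len)
  have new: "(nths xs A @ [x]) ! rank A ?n = x"
    using nth_append_length[of "nths xs A" x] by (simp add: len)
  show ?case
  proof (cases "?n \<in> A")
    case True
    then have "A \<inter> {..<Suc ?n} = insert ?n (A \<inter> {..<?n})" by auto
    with True show ?thesis
      using snoc.IH by (simp add: nths_append old old' new len add.commute)
  next
    case False
    then have "A \<inter> {..<Suc ?n} = A \<inter> {..<?n}" by (auto simp: less_Suc_eq)
    with False show ?thesis
      using snoc.IH by (simp add: nths_append old)
  qed
qed simp

text \<open>Trace positions past the end read as 0, so the window sum can be cut to the length of
  the trace before changing variables by \<open>sum_nths\<close>.\<close>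

lemma window_sum_nths:
  assumes "A \<subseteq> {..<length xs}"
  shows "window_sum w (nths xs A) i = (\<Sum>p\<in>window_positions w A i. of_bool (xs ! p))"
proof -
  have A: "A \<inter> {..<length xs} = A" "finite A"
    using assms finite_subset by auto
  have "window_sum w (nths xs A) i =
      (\<Sum>j<length (nths xs A). if j \<in> S w i then of_bool (nths xs A ! j) else 0)"
    unfolding window_sum_def bit_at_def
    by (simp add: S_eq sum.If_cases flip: sum.inter_restrict)
       (simp add: Int_def conj_commute)
  also have "\<dots> = (\<Sum>p\<in>A. if rank A p \<in> S w i then of_bool (xs ! p) else 0)"
    by (subst sum_nths) (simp add: A)
  also have "\<dots> = (\<Sum>p\<in>window_positions w A i. of_bool (xs ! p))"
    unfolding window_positions_def using A(2) by (rule sum.inter_filter[symmetric])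
  finally show ?thesis .
qed

lemma card_window_positions:
  assumes "finite A" "2 * w * i + w \<le> card A"
  shows "card (window_positions w A i) = w"
proof -
  obtain m where m: "A \<subseteq> {..<m}"
    using assms(1) finite_nat_iff_bounded by blast
  \<comment> \<open>A dummy string: only its length matters, since the summand passed to
    \<open>sum_nths\<close> ignores the bits.\<close>
  define xs where "xs = replicate m True"
  have A: "A \<inter> {..<length xs} = A" using m by (auto simp: xs_def)
  then have len: "length (nths xs A) = card A"
    by (simp add: length_nths Int_def conj_commute)
  have "card (window_positions w A i) = (\<Sum>p\<in>A. if rank A p \<in> S w i then 1 else 0)"
    unfolding window_positions_def card_eq_sum
    using assms(1) by (rule sum.inter_filter)
  also have "\<dots> = (\<Sum>j<card A. if j \<in> S w i then 1 else 0)"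
    using sum_nths[where G = "\<lambda>j _. if j \<in> S w i then 1 else (0::nat)" and A = A and xs = xs]
    by (simp add: A len)
  also have "\<dots> = card ({..<card A} \<inter> S w i)"
    by (simp add: sum.If_cases)
  also have "{..<card A} \<inter> S w i = S w i"
    using assms(2) by (auto simp: S_eq)
  finally show ?thesis by (simp add: S_eq)
qed

text \<open>A source position from \<open>M\<close> on has rank at least \<open>V\<close>, past the
  end of the window; hence windows ending by \<open>V\<close> read only the first \<open>M\<close>
  source bits.\<close>

lemma rank_less_cutoff:
  assumes "V \<le> rank A M" "p \<in> window_positions w A i" "2 * w * i + w \<le> V"
  shows "p < M"
proof (rule ccontr)
  assume "\<not> p < M"
  then have "rank A M \<le> rank A p" by (intro rank_mono) simp
  with assms show False by (auto simp: window_positions_def S_eq)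
qed

text \<open>Consecutive windows are separated by a gap of \<open>w\<close> trace positions, so a
  source position common to two windows with different indices would have ranks in \<open>A\<close>
  and \<open>B\<close> that differ by more than \<open>w\<close>. Taking \<open>B = A\<close> covers
  two windows of one trace.\<close>

lemma window_positions_disjoint:
  assumes close: "\<And>p. p \<le> M \<Longrightarrow> \<bar>real (rank A p) - real (rank B p)\<bar> \<le> real w"
    and M: "V \<le> rank A M" and "2 * w * i + w \<le> V" and "i \<noteq> i'"
  shows "window_positions w A i \<inter> window_positions w B i' = {}"
proof (rule ccontr)
  assume "window_positions w A i \<inter> window_positions w B i' \<noteq> {}"
  then obtain p where p: "p \<in> window_positions w A i" "p \<in> window_positions w B i'" by auto
  then have "p \<le> M" using rank_less_cutoff[OF M p(1)] assms by auto
  note c = close[OF this]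
  consider "Suc i \<le> i'" | "Suc i' \<le> i" using \<open>i \<noteq> i'\<close> by linarith
  then show False
  proof cases
    case 1
    then have "2 * w * i + 2 * w \<le> 2 * w * i'"
      using mult_le_mono2[of "Suc i" i' "2 * w"] by simp
    then show False using p c by (auto simp: window_positions_def S_eq)
  next
    case 2
    then have "2 * w * i' + 2 * w \<le> 2 * w * i"
      using mult_le_mono2[of "Suc i'" i "2 * w"] by simp
    then show False using p c by (auto simp: window_positions_def S_eq)
  qed
qed

text \<open>If \<open>q * p\<close> lies inside the window with a margin of \<open>\<delta>\<close>,
  both ranks of \<open>p\<close> lie in the window. Such \<open>p\<close> fill an interval of length
  about \<open>(w - 2 * \<delta>) / q\<close>, in which the common survivors have density close to
  \<open>q\<^sup>2\<close>.\<close>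

lemma window_positions_overlap:
  fixes q :: real and M :: nat
  assumes q: "0 < q" "q < 1" and fin: "finite A" "finite B"
    and w: "10 \<le> q * real w"
    and A: "\<And>p. p \<le> M \<Longrightarrow> \<bar>real (rank A p) - q * p\<bar> \<le> q * w / 10"
    and B: "\<And>p. p \<le> M \<Longrightarrow> \<bar>real (rank B p) - q * p\<bar> \<le> q * w / 10"
    and AB: "\<And>p. p \<le> M \<Longrightarrow> \<bar>real (rank (A \<inter> B) p) - q\<^sup>2 * p\<bar> \<le> q * w / 10"
    and M: "2 * real w * i + w \<le> q * M"
  shows "q * w / 2 \<le> card (window_positions w A i \<inter> window_positions w B i)"
proof -
  define \<delta> where "\<delta> = q * w / 10"
  have \<delta>: "1 \<le> \<delta>" "10 * \<delta> = q * w" using w by (auto simp: \<delta>_def)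
  define s where "s = 2 * real w * i"
  \<comment> \<open>Rounding up makes \<open>a\<close> and \<open>b\<close> exact thresholds:
    \<open>a \<le> p < b\<close> holds iff
    \<open>s + \<delta> \<le> q * p < s + w - \<delta>\<close>.\<close>
  define a where "a = nat \<lceil>(s + \<delta>) / q\<rceil>"
  define b where "b = nat \<lceil>(s + w - \<delta>) / q\<rceil>"
  have qw: "q * w \<le> w" using q by (simp add: mult_left_le_one_le)
  have s0: "0 \<le> s" by (simp add: s_def)
  have dw: "2 * \<delta> \<le> w" using qw \<delta> by linarith
  have "0 \<le> (s + \<delta>) / q" "0 \<le> (s + w - \<delta>) / q"
    using s0 \<delta> q dw by (auto intro!: divide_nonneg_pos)
  then have ra: "real a = of_int \<lceil>(s + \<delta>) / q\<rceil>" and rb: "real b = of_int \<lceil>(s + w - \<delta>) / q\<rceil>"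
    unfolding a_def b_def by (auto intro!: of_nat_nat)
  have ceiling_ge: "t \<le> q * of_int \<lceil>t / q\<rceil>" for t
    using mult_left_mono[OF le_of_int_ceiling[of "t / q"], of q] q by simp
  have ceiling_le: "q * of_int \<lceil>t / q\<rceil> \<le> t + q" for t
    using of_int_ceiling_le_add_one[of "t / q"] q by (simp add: field_simps)
  have a1: "s + \<delta> \<le> q * a" and a2: "q * a \<le> s + \<delta> + q"
    unfolding ra by (rule ceiling_ge ceiling_le)+
  have b1: "s + w - \<delta> \<le> q * b"
    unfolding rb by (rule ceiling_ge)
  have b3: "q * p < s + w - \<delta>" if "p < b" for p
  proof -
    have "int p < \<lceil>(s + w - \<delta>) / q\<rceil>" using that unfolding b_def by linarith
    then have "real p < (s + w - \<delta>) / q" by (simp add: less_ceiling_iff)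
    then show ?thesis using q by (simp add: field_simps)
  qed
  have bM: "b \<le> M"
  proof -
    have "(s + w - \<delta>) / q \<le> M" using M q \<delta> by (simp add: s_def field_simps)
    then have "\<lceil>(s + w - \<delta>) / q\<rceil> \<le> int M" by (simp add: ceiling_le_iff)
    then show ?thesis unfolding b_def by linarith
  qed
  have ab: "a \<le> b" unfolding a_def b_def using dw q
    by (intro nat_mono ceiling_mono divide_right_mono) auto
  have sub: "(A \<inter> B) \<inter> {a..<b} \<subseteq> window_positions w A i \<inter> window_positions w B i"
  proof
    fix p assume p: "p \<in> (A \<inter> B) \<inter> {a..<b}"
    have lo: "s + \<delta> \<le> q * p"
      using a1 p q by (smt (verit) IntD2 atLeastLessThan_iff mult_left_mono of_nat_mono)
    have hi: "q * p < s + w - \<delta>" using b3 p by auto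
    have pM: "p \<le> M" using p bM by auto
    have in_S: "r \<in> S w i" if "\<bar>real r - q * p\<bar> \<le> \<delta>" for r
    proof -
      have "s \<le> real r" "real r < s + w" using that lo hi by linarith+
      then have "real (2 * w * i) \<le> real r" "real r < real (2 * w * i + w)"
        by (simp_all add: s_def)
      then show ?thesis unfolding S_eq atLeastLessThan_iff
        by (simp only: of_nat_le_iff of_nat_less_iff)
    qed
    show "p \<in> window_positions w A i \<inter> window_positions w B i"
      using p in_S A[OF pM] B[OF pM] by (auto simp: window_positions_def \<delta>_def)
  qed
  have "rank (A \<inter> B) b = rank (A \<inter> B) a + card ((A \<inter> B) \<inter> {a..<b})"
  proof -
    have "(A \<inter> B) \<inter> {..<b} = (A \<inter> B) \<inter> {..<a} \<union> (A \<inter> B) \<inter> {a..<b}" using ab by auto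
    moreover have "card ((A \<inter> B) \<inter> {..<a} \<union> (A \<inter> B) \<inter> {a..<b}) =
        card ((A \<inter> B) \<inter> {..<a}) + card ((A \<inter> B) \<inter> {a..<b})"
      using fin by (intro card_Un_disjoint) auto
    ultimately show ?thesis unfolding rank_def by (simp only:)
  qed
  then have "real (card ((A \<inter> B) \<inter> {a..<b})) = real (rank (A \<inter> B) b) - real (rank (A \<inter> B) a)"
    by simp
  moreover have "q\<^sup>2 * b - \<delta> \<le> real (rank (A \<inter> B) b)"
    using AB[OF bM] unfolding \<delta>_def by linarith
  moreover have "real (rank (A \<inter> B) a) \<le> q\<^sup>2 * a + \<delta>"
    using AB[OF order_trans[OF ab bM]] unfolding \<delta>_def by linarith
  \<comment> \<open>Rounding \<open>a\<close> up costs at most \<open>q\<close> in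
    \<open>q * a\<close>, which becomes \<open>q * q\<close> here.\<close>
  moreover have "q * w - 2 * (q * \<delta>) - q * q \<le> q\<^sup>2 * b - q\<^sup>2 * a"
  proof -
    have "q * (w - 2 * \<delta> - q) \<le> q * (q * b - q * a)"
      using a2 b1 q by (intro mult_left_mono) auto
    then show ?thesis by (simp add: power2_eq_square algebra_simps)
  qed
  moreover have "q * \<delta> \<le> \<delta>" "q * q \<le> 1" using q \<delta> by (auto simp: mult_le_one)
  \<comment> \<open>The loss of \<open>5 * \<delta>\<close> is \<open>2 * \<delta>\<close> from the
    two ranks of \<open>A \<inter> B\<close>, \<open>2 * (q * \<delta>) \<le> 2 * \<delta>\<close>
    from the margins, and \<open>q * q \<le> 1 \<le> \<delta>\<close> from rounding. It equals
    \<open>q * w / 2\<close>.\<close>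
  ultimately have "q * w - 5 * \<delta> \<le> real (card ((A \<inter> B) \<inter> {a..<b}))"
    using \<delta>(1) by linarith
  also have "\<dots> \<le> card (window_positions w A i \<inter> window_positions w B i)"
    using sub fin unfolding of_nat_le_iff
    by (intro card_mono) (auto simp: window_positions_def)
  finally show ?thesis using \<delta> by linarith
qed

section \<open>Separating the bits from the deletions\<close>

text \<open>Conditioning on \<open>k\<close>: the conditional probability of \<open>E\<close> is at
  most 1 where \<open>G\<close> fails and at most \<open>b\<close> elsewhere on the support.\<close>

lemma prob_bind_pmf_le:
  assumes bad: "measure_pmf.prob p {k. \<not> G k} \<le> a"
    and good: "\<And>k. k \<in> set_pmf p \<Longrightarrow> G k \<Longrightarrow> measure_pmf.prob (f k) E \<le> b" and "0 \<le> b"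
  shows "measure_pmf.prob (bind_pmf p f) E \<le> a + b"
proof -
  have "measure_pmf.prob (bind_pmf p f) E = (\<integral>k. measure_pmf.prob (f k) E \<partial>p)"
    unfolding measure_pmf_bind
    by (rule measure_pmf.measure_bind[where N = "count_space UNIV"]) (simp_all add: measure_pmf_in_subprob_space)
  also have "\<dots> \<le> (\<integral>k. indicator {k. \<not> G k} k + b \<partial>p)"
  proof (rule integral_mono_AE)
    show "integrable p (\<lambda>k. measure_pmf.prob (f k) E)"
      by (rule measure_pmf.integrable_const_bound[where B = 1]) auto
    show "AE k in p. measure_pmf.prob (f k) E \<le> indicator {k. \<not> G k} k + b"
    proof (rule AE_pmfI)
      fix k assume "k \<in> set_pmf p"
      moreover have "measure_pmf.prob (f k) E \<le> 1 + b"
        using measure_pmf.prob_le_1[of "f k" E] \<open>0 \<le> b\<close> by linarith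
      ultimately show "measure_pmf.prob (f k) E \<le> indicator {k. \<not> G k} k + b"
        using good[of k] by (cases "G k") auto
    qed
    show "integrable p (\<lambda>k. indicator {k. \<not> G k} k + b)"
      by (rule measure_pmf.integrable_const_bound[where B = "1 + b"])
         (use \<open>0 \<le> b\<close> in \<open>auto simp: indicator_def\<close>)
  qed
  also have "\<dots> = measure_pmf.prob p {k. \<not> G k} + b"
    by (subst Bochner_Integration.integral_add)
       (auto intro!: measure_pmf.integrable_const_bound[where B = 1] simp: measure_pmf.prob_space)
  finally show ?thesis using bad by simp
qed

text \<open>Makes the bits independent coordinates of a product distribution.\<close>

lemma random_string_eq_coins:
  "random_string m =
    map_pmf (\<lambda>f. map f [0..<m]) (Pi_pmf {..<m} False (\<lambda>_. bernoulli_pmf (1/2)))"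
proof -
  have "bij_betw (\<lambda>f. map f [0..<m]) (PiE_dflt {..<m} False (\<lambda>_. UNIV)) {x. length x = m}"
    by (rule bij_betwI[where g = "\<lambda>x i. if i < m then x ! i else False"])
       (auto simp: PiE_dflt_def fun_eq_iff intro: nth_equalityI)
  then show ?thesis
    unfolding random_string_def bernoulli_pmf_half_conv_pmf_of_set
    by (subst Pi_pmf_of_set)
       (auto intro!: map_pmf_of_set_bij_betw[symmetric] simp: PiE_dflt_empty_iff)
qed

text \<open>Lets Case 2 run on one family of coins too: its two sources become the halves of a
  single string.\<close>

lemma pair_random_string:
  "pair_pmf (random_string m) (random_string k) =
    map_pmf (\<lambda>z. (take m z, drop m z)) (random_string (m + k))"
proof -
  have fin: "finite {x::bool list. length x = n}" for n
    using finite_lists_length_eq[of "UNIV :: bool set"] by simp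
  have ne: "{x::bool list. length x = n} \<noteq> {}" for n
    by (auto intro: exI[of _ "replicate n True"])
  have "bij_betw (\<lambda>z::bool list. (take m z, drop m z)) {z. length z = m + k}
      ({x. length x = m} \<times> {x. length x = k})"
    by (rule bij_betwI[where g = "\<lambda>(x, y). x @ y"]) auto
  then have "map_pmf (\<lambda>z. (take m z, drop m z)) (random_string (m + k)) =
      pmf_of_set ({x::bool list. length x = m} \<times> {x. length x = k})"
    unfolding random_string_def using fin ne by (intro map_pmf_of_set_bij_betw) auto
  also have "\<dots> = pair_pmf (random_string m) (random_string k)"
    unfolding random_string_def using fin ne
    by (intro pmf_eqI) (auto simp: pmf_pair pmf_of_set card_cartesian_product indicator_def)
  finally show ?thesis ..
qed

text \<open>Zipping is injective, so the point masses on both sides can be compared coordinate by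
  coordinate.\<close>

lemma pair_Pi_pmf:
  assumes "finite A"
  shows "pair_pmf (Pi_pmf A d p) (Pi_pmf A e r) =
    map_pmf (\<lambda>h. (fst \<circ> h, snd \<circ> h)) (Pi_pmf A (d, e) (\<lambda>i. pair_pmf (p i) (r i)))"
proof (rule pmf_eqI)
  fix fg :: "('a \<Rightarrow> 'b) \<times> ('a \<Rightarrow> 'c)"
  obtain f g where fg: "fg = (f, g)" by (cases fg)
  let ?\<phi> = "\<lambda>h. (fst \<circ> h, snd \<circ> h) :: ('a \<Rightarrow> 'b) \<times> ('a \<Rightarrow> 'c)"
  have "inj ?\<phi>" by (auto simp: inj_def fun_eq_iff prod_eq_iff)
  moreover have "(f, g) = ?\<phi> (\<lambda>i. (f i, g i))" by (auto simp: fun_eq_iff)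
  ultimately have "pmf (map_pmf ?\<phi> (Pi_pmf A (d, e) (\<lambda>i. pair_pmf (p i) (r i)))) (f, g) =
      pmf (Pi_pmf A (d, e) (\<lambda>i. pair_pmf (p i) (r i))) (\<lambda>i. (f i, g i))"
    by (simp only: pmf_map_inj'[where f = ?\<phi>])
  then show "pmf (pair_pmf (Pi_pmf A d p) (Pi_pmf A e r)) fg =
      pmf (map_pmf ?\<phi> (Pi_pmf A (d, e) (\<lambda>i. pair_pmf (p i) (r i)))) fg"
    using assms by (auto simp: fg pmf_pair pmf_Pi prod.distrib)
qed

text \<open>Coordinate \<open>i\<close> tells whether source position \<open>i\<close> survives in
  the first and in the second trace. Pairing the two makes joint survival, an event of probability
  \<open>q\<^sup>2\<close>, depend on a single coordinate.\<close>

definition keep_pairs :: "real \<Rightarrow> nat \<Rightarrow> (nat \<Rightarrow> bool \<times> bool) pmf" where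
  "keep_pairs q m =
    Pi_pmf {..<m} (False, False) (\<lambda>_. pair_pmf (bernoulli_pmf q) (bernoulli_pmf q))"

lemma pair_deletion_channel:
  assumes "length x = m" "length y = m"
  shows "pair_pmf (deletion_channel q x) (deletion_channel q y) =
    map_pmf (\<lambda>\<kappa>. (nths x {i. fst (\<kappa> i)}, nths y {i. snd (\<kappa> i)})) (keep_pairs q m)"
  unfolding deletion_channel_def keep_pairs_def assms
  by (subst map_pair[symmetric]) (simp add: pair_Pi_pmf map_pmf_comp comp_def)

text \<open>The survivors depend on the source only through its length, so they can be drawn first
  and the bits afterwards. This is the form to which \<open>prob_bind_pmf_le\<close>
  applies.\<close>

lemma traces_same_source_eq:
  "traces_same_source q m = bind_pmf (keep_pairs q m) (\<lambda>\<kappa>.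
    map_pmf (\<lambda>x. (nths x {i. fst (\<kappa> i)}, nths x {i. snd (\<kappa> i)})) (random_string m))"
proof -
  have "length x = m" if "x \<in> set_pmf (random_string m)" for x
    using that by (auto simp: random_string_eq_coins)
  then have "traces_same_source q m = bind_pmf (random_string m) (\<lambda>x.
      map_pmf (\<lambda>\<kappa>. (nths x {i. fst (\<kappa> i)}, nths x {i. snd (\<kappa> i)})) (keep_pairs q m))"
    unfolding traces_same_source_def
    by (intro bind_pmf_cong refl pair_deletion_channel) auto
  then show ?thesis
    unfolding map_pmf_def by (rule trans) (rule bind_commute_pmf)
qed

lemma traces_indep_sources_eq:
  "traces_indep_sources q m = bind_pmf (keep_pairs q m) (\<lambda>\<kappa>.
    map_pmf (\<lambda>z. (nths (take m z) {i. fst (\<kappa> i)}, nths (drop m z) {i. snd (\<kappa> i)}))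
      (random_string (m + m)))"
proof -
  have "length x = m + m" if "x \<in> set_pmf (random_string (m + m))" for x
    using that by (auto simp: random_string_eq_coins)
  then have "traces_indep_sources q m = bind_pmf (random_string (m + m)) (\<lambda>z.
      map_pmf (\<lambda>\<kappa>. (nths (take m z) {i. fst (\<kappa> i)}, nths (drop m z) {i. snd (\<kappa> i)}))
        (keep_pairs q m))"
    unfolding traces_indep_sources_def pair_random_string bind_map_pmf
    by (auto intro!: bind_pmf_cong pair_deletion_channel)
  then show ?thesis
    unfolding map_pmf_def by (rule trans) (rule bind_commute_pmf)
qed

section \<open>Hoeffding bounds for counts of independent events\<close>

lemma (in prob_space) Hoeffding_count:
  fixes E :: "'i \<Rightarrow> 'a \<Rightarrow> bool"
  assumes J: "finite J" "J \<noteq> {}" and "0 \<le> \<delta>"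
    and indep: "indep_vars (\<lambda>_. borel) (\<lambda>p \<omega>. of_bool (E p \<omega>) :: real) J"
    and mean: "\<And>p. p \<in> J \<Longrightarrow> expectation (\<lambda>\<omega>. of_bool (E p \<omega>) :: real) = \<rho>"
  shows "prob {\<omega> \<in> space M. \<delta> \<le> \<bar>real (card {p \<in> J. E p \<omega>}) - \<rho> * card J\<bar>}
    \<le> 2 * exp (- 2 * \<delta>\<^sup>2 / card J)"
proof -
  define \<mu> where "\<mu> = (\<Sum>p\<in>J. expectation (\<lambda>\<omega>. of_bool (E p \<omega>) :: real))"
  have \<mu>: "\<mu> = \<rho> * card J"
    unfolding \<mu>_def by (simp add: mean)
  interpret H: Hoeffding_ineq M J "\<lambda>p \<omega>. of_bool (E p \<omega>)" "\<lambda>_. 0" "\<lambda>_. 1" \<mu>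
    using indep J(1) by unfold_locales (auto simp: \<mu>_def)
  have "(\<Sum>p\<in>J. of_bool (E p \<omega>)) = real (card {p \<in> J. E p \<omega>})" for \<omega>
    using J by (simp add: Collect_conj_eq)
  moreover have "prob {\<omega> \<in> space M. \<delta> \<le> \<bar>(\<Sum>p\<in>J. of_bool (E p \<omega>)) - \<mu>\<bar>}
      \<le> 2 * exp (- 2 * \<delta>\<^sup>2 / (\<Sum>p\<in>J. (1 - 0)\<^sup>2))"
    using J \<open>0 \<le> \<delta>\<close> by (intro H.Hoeffding_ineq_abs_ge) (auto simp: card_gt_0_iff)
  ultimately show ?thesis by (simp add: \<mu>)
qed

text \<open>When \<open>J\<close> is an initial segment and \<open>\<phi>\<close> selects survival,
  the count is a rank; this is the tail bound behind \<open>prob_not_regular\<close>.\<close>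

lemma Pi_pmf_Hoeffding:
  fixes \<phi> :: "'b \<Rightarrow> bool" and r :: "'b pmf"
  assumes "finite I" "J \<subseteq> I" "J \<noteq> {}" "0 \<le> \<delta>"
  defines "\<rho> \<equiv> measure_pmf.prob r {b. \<phi> b}"
  shows "measure_pmf.prob (Pi_pmf I d (\<lambda>_. r))
      {\<kappa>. \<delta> \<le> \<bar>real (card {p \<in> J. \<phi> (\<kappa> p)}) - \<rho> * card J\<bar>} \<le> 2 * exp (- 2 * \<delta>\<^sup>2 / card J)"
proof -
  let ?\<mu> = "measure_pmf (Pi_pmf I d (\<lambda>_. r))"
  let ?X = "\<lambda>p \<kappa>. of_bool (\<phi> (\<kappa> p)) :: real"
  have finJ: "finite J" using assms finite_subset by blast
  have mean: "measure_pmf.expectation (Pi_pmf I d (\<lambda>_. r)) (?X p) = \<rho>" if "p \<in> J" for p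
  proof -
    have "measure_pmf.expectation (Pi_pmf I d (\<lambda>_. r)) (?X p) =
        measure_pmf.expectation (map_pmf (\<lambda>\<kappa>. \<kappa> p) (Pi_pmf I d (\<lambda>_. r)))
          (indicator {b. \<phi> b})"
      unfolding integral_map_pmf
      by (intro Bochner_Integration.integral_cong) (auto simp: indicator_def)
    also have "map_pmf (\<lambda>\<kappa>. \<kappa> p) (Pi_pmf I d (\<lambda>_. r)) = r"
      using that assms by (auto simp: Pi_pmf_component)
    finally show ?thesis by (simp add: \<rho>_def)
  qed
  have "prob_space.indep_vars ?\<mu> (\<lambda>_. count_space UNIV) (\<lambda>p \<kappa>. \<kappa> p) J"
    by (rule prob_space.indep_vars_subset[OF measure_pmf.prob_space_axioms
          indep_vars_Pi_pmf[OF assms(1)] assms(2)])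
  then have "prob_space.indep_vars ?\<mu> (\<lambda>_. borel) ?X J"
    by (intro prob_space.indep_vars_compose2[where X = "\<lambda>p \<kappa>. \<kappa> p"
          and M' = "\<lambda>_. count_space UNIV" and Y = "\<lambda>_ b. of_bool (\<phi> b)"]
        measure_pmf.prob_space_axioms) simp_all
  from prob_space.Hoeffding_count[OF measure_pmf.prob_space_axioms finJ
      \<open>J \<noteq> {}\<close> \<open>0 \<le> \<delta>\<close> this mean]
  show ?thesis by simp
qed

section \<open>Quadratic functions of independent signs\<close>

abbreviation coins :: "'i set \<Rightarrow> ('i \<Rightarrow> bool) pmf" where
  "coins I \<equiv> Pi_pmf I False (\<lambda>_. bernoulli_pmf (1/2))"

text \<open>A Rademacher sum with coefficients \<open>c\<close>: each coin is read as a
  sign.\<close>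

definition signed_sum :: "'i set \<Rightarrow> ('i \<Rightarrow> real) \<Rightarrow> ('i \<Rightarrow> bool) \<Rightarrow> real" where
  "signed_sum I c f = (\<Sum>p\<in>I. c p * (if f p then 1 else - 1))"

lemma finite_set_coins:
  assumes "finite I"
  shows "finite (set_pmf (coins I))"
  using assms by (simp add: set_Pi_pmf finite_PiE_dflt)

lemma integrable_coins:
  fixes F :: "('i \<Rightarrow> bool) \<Rightarrow> real"
  shows "finite I \<Longrightarrow> integrable (measure_pmf (coins I)) F"
  by (intro integrable_measure_pmf_finite finite_set_coins)

text \<open>Averaging over the coin at \<open>x\<close> gives the recursion that drives both moment
  computations.\<close>

lemma expectation_coins_insert:
  fixes F :: "('i \<Rightarrow> bool) \<Rightarrow> real"
  assumes "finite I" "x \<notin> I"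
  shows "measure_pmf.expectation (coins (insert x I)) F =
    measure_pmf.expectation (coins I) (\<lambda>f. (F (f(x := True)) + F (f(x := False))) / 2)"
proof -
  have "measure_pmf.expectation (coins (insert x I)) F =
      measure_pmf.expectation (bind_pmf (bernoulli_pmf (1/2))
        (\<lambda>b. map_pmf (\<lambda>f. f(x := b)) (coins I))) F"
    by (subst Pi_pmf_insert'[OF assms]) (simp add: map_pmf_def)
  also have "\<dots> = (\<Sum>b\<in>UNIV. pmf (bernoulli_pmf (1/2)) b *\<^sub>R
      measure_pmf.expectation (map_pmf (\<lambda>f. f(x := b)) (coins I)) F)"
    using finite_set_coins[OF assms(1)] by (intro pmf_expectation_bind) auto
  also have "\<dots> = measure_pmf.expectation (coins I) (\<lambda>f. F (f(x := True))) / 2 +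
      measure_pmf.expectation (coins I) (\<lambda>f. F (f(x := False))) / 2"
    by (simp add: UNIV_bool)
  also have "\<dots> = measure_pmf.expectation (coins I) (\<lambda>f. (F (f(x := True)) + F (f(x := False))) / 2)"
    by (simp add: add_divide_distrib integrable_coins[OF assms(1)])
  finally show ?thesis .
qed

lemma signed_sum_insert:
  assumes "finite I" "x \<notin> I"
  shows "signed_sum (insert x I) c (f(x := b)) = signed_sum I c f + (if b then c x else - c x)"
proof -
  have "signed_sum I c (f(x := b)) = signed_sum I c f"
    unfolding signed_sum_def using assms by (intro sum.cong) auto
  with assms show ?thesis by (simp add: signed_sum_def)
qed

lemma signed_sum_second_moment:
  assumes "finite I"
  shows "measure_pmf.expectation (coins I) (\<lambda>f. (signed_sum I c f)\<^sup>2) = (\<Sum>p\<in>I. (c p)\<^sup>2)"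
  using assms
proof (induction I)
  case (insert x I)
  have "((s + c x)\<^sup>2 + (s + - c x)\<^sup>2) / 2 = s\<^sup>2 + (c x)\<^sup>2" for s
    by (simp add: power2_eq_square algebra_simps)
  then show ?case
    using insert by (simp add: expectation_coins_insert signed_sum_insert integrable_coins)
qed (simp add: signed_sum_def)

text \<open>Odd powers of \<open>c x\<close> cancel in the average over its sign. The constant 3 is
  the Gaussian one.\<close>

lemma signed_sum_fourth_moment:
  assumes "finite I"
  shows "measure_pmf.expectation (coins I) (\<lambda>f. signed_sum I c f ^ 4) \<le> 3 * (\<Sum>p\<in>I. (c p)\<^sup>2)\<^sup>2"
  using assms
proof (induction I)
  case (insert x I)
  define v where "v = (\<Sum>p\<in>I. (c p)\<^sup>2)"
  have c4: "0 \<le> c x ^ 4" by simp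
  have "((s + c x) ^ 4 + (s + - c x) ^ 4) / 2 = s ^ 4 + (6 * (c x)\<^sup>2 * s\<^sup>2 + c x ^ 4)" for s
    by (simp add: power2_eq_square power4_eq_xxxx algebra_simps)
  then have "measure_pmf.expectation (coins (insert x I)) (\<lambda>f. signed_sum (insert x I) c f ^ 4) =
      measure_pmf.expectation (coins I) (\<lambda>f. signed_sum I c f ^ 4) + (6 * (c x)\<^sup>2 * v + c x ^ 4)"
    using insert
    by (simp add: expectation_coins_insert signed_sum_insert integrable_coins
        signed_sum_second_moment v_def)
  \<comment> \<open>Enlarging \<open>c x ^ 4\<close> to three times itself completes
    \<open>3 * (v + (c x)\<^sup>2)\<^sup>2\<close>.\<close>
  also have "\<dots> \<le> 3 * v\<^sup>2 + (6 * (c x)\<^sup>2 * v + 3 * c x ^ 4)"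
    using insert.IH c4 unfolding v_def by linarith
  also have "\<dots> = 3 * (\<Sum>p\<in>insert x I. (c p)\<^sup>2)\<^sup>2"
    using insert by (simp add: v_def power2_eq_square power4_eq_xxxx algebra_simps)
  finally show ?case .
qed (simp add: signed_sum_def)

text \<open>With \<open>v\<close> the sum of the squared coefficients, the fourth moment is at most
  \<open>3 * v\<^sup>2\<close> and the squared second moment is \<open>v\<^sup>2\<close>; the factor
  1/4 turns the difference into \<open>2 * v\<^sup>2 / 16\<close>.\<close>

lemma variance_signed_sum_squared:
  assumes "finite I"
  shows "measure_pmf.variance (coins I) (\<lambda>f. (signed_sum I c f)\<^sup>2 / 4)
    \<le> (\<Sum>p\<in>I. (c p)\<^sup>2)\<^sup>2 / 8"
proof -
  have "measure_pmf.variance (coins I) (\<lambda>f. (signed_sum I c f)\<^sup>2 / 4) =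
      measure_pmf.expectation (coins I) (\<lambda>f. signed_sum I c f ^ 4) / 16 -
      (\<Sum>p\<in>I. (c p)\<^sup>2)\<^sup>2 / 16"
    by (subst measure_pmf.variance_eq)
       (simp_all add: integrable_coins assms signed_sum_second_moment power_divide
          flip: power_mult)
  then show ?thesis
    using signed_sum_fourth_moment[OF assms, of c] by simp
qed

section \<open>Variances, majorities and independence of disjoint blocks\<close>

lemma (in prob_space) variance_sum_indep:
  fixes X :: "'i \<Rightarrow> 'a \<Rightarrow> real"
  assumes "finite I" "indep_vars (\<lambda>_. borel) X I"
    and "\<And>F :: 'a \<Rightarrow> real. integrable M F"
  shows "variance (\<lambda>\<omega>. \<Sum>i\<in>I. X i \<omega>) = (\<Sum>i\<in>I. variance (X i))"
  using assms(1,2)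
proof (induction I)
  case (insert i I)
  \<comment> \<open>Blanket integrability is available for \<open>coins I\<close> with finite
    \<open>I\<close>, whose support is finite.\<close>
  note int [simp] = assms(3)
  define S where "S = (\<lambda>\<omega>. \<Sum>i\<in>I. X i \<omega>)"
  have "indep_var borel (X i) borel S"
    unfolding S_def using insert by (intro indep_vars_sum) auto
  then have prod: "expectation (\<lambda>\<omega>. X i \<omega> * S \<omega>) = expectation (X i) * expectation S"
    by (intro indep_var_lebesgue_integral) auto
  have "expectation (\<lambda>\<omega>. (X i \<omega> + S \<omega>)\<^sup>2) =
      expectation (\<lambda>\<omega>. (X i \<omega>)\<^sup>2) + expectation (\<lambda>\<omega>. (S \<omega>)\<^sup>2) +
      2 * (expectation (X i) * expectation S)"
    by (simp add: power2_sum mult.assoc prod)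
  moreover have "variance (\<lambda>\<omega>. X i \<omega> + S \<omega>) =
      expectation (\<lambda>\<omega>. (X i \<omega> + S \<omega>)\<^sup>2) - (expectation (\<lambda>\<omega>. X i \<omega> + S \<omega>))\<^sup>2"
    by (rule variance_eq) simp_all
  moreover have "variance (X i) = expectation (\<lambda>\<omega>. (X i \<omega>)\<^sup>2) - (expectation (X i))\<^sup>2"
      "variance S = expectation (\<lambda>\<omega>. (S \<omega>)\<^sup>2) - (expectation S)\<^sup>2"
    by (rule variance_eq; simp)+
  moreover have "expectation (\<lambda>\<omega>. X i \<omega> + S \<omega>) = expectation (X i) + expectation S"
    by (rule Bochner_Integration.integral_add) simp_all
  ultimately have "variance (\<lambda>\<omega>. X i \<omega> + S \<omega>) = variance (X i) + variance S"
    by (simp only: power2_sum)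
  moreover have "variance S = (\<Sum>i\<in>I. variance (X i))"
    unfolding S_def using insert indep_vars_subset[of "\<lambda>_. borel" X "insert i I" I] by auto
  ultimately show ?case using insert.hyps by (simp add: S_def)
qed (simp add: prob_space)

text \<open>The expected count is at most \<open>K / 3\<close>, so reaching \<open>K / 2\<close> is
  a deviation of at least \<open>K / 6\<close>, and
  \<open>2 * (K / 6)\<^sup>2 / K = K / 18\<close>.\<close>

lemma (in prob_space) majority_indep:
  fixes E :: "nat \<Rightarrow> 'a \<Rightarrow> bool"
  assumes "0 < K" and indep: "indep_vars (\<lambda>_. borel) (\<lambda>j \<omega>. of_bool (E j \<omega>) :: real) {..<K}"
    and E: "\<And>j. j < K \<Longrightarrow> expectation (\<lambda>\<omega>. of_bool (E j \<omega>) :: real) \<le> 1/3"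
  shows "prob {\<omega> \<in> space M. K \<le> 2 * card {j. j < K \<and> E j \<omega>}} \<le> exp (- real K / 18)"
proof -
  define \<mu> where "\<mu> = (\<Sum>j<K. expectation (\<lambda>\<omega>. of_bool (E j \<omega>) :: real))"
  interpret H: Hoeffding_ineq M "{..<K}" "\<lambda>j \<omega>. of_bool (E j \<omega>)" "\<lambda>_. 0" "\<lambda>_. 1" \<mu>
    using indep by unfold_locales (auto simp: \<mu>_def)
  have "\<mu> \<le> (\<Sum>j<K. 1/3)" unfolding \<mu>_def using E by (intro sum_mono) auto
  then have \<mu>: "real K / 6 \<le> real K / 2 - \<mu>" by simp
  have count: "(\<Sum>j<K. of_bool (E j \<omega>)) = real (card {j. j < K \<and> E j \<omega>})" for \<omega>
    by (simp add: Int_def)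
  have "prob {\<omega> \<in> space M. K \<le> 2 * card {j. j < K \<and> E j \<omega>}} =
      prob {\<omega> \<in> space M. \<mu> + (real K / 2 - \<mu>) \<le> (\<Sum>j<K. of_bool (E j \<omega>))}"
    unfolding count by (intro arg_cong[where f = prob]) auto
  also have "\<dots> \<le> exp (- 2 * (real K / 2 - \<mu>)\<^sup>2 / (\<Sum>j<K. (1 - 0)\<^sup>2))"
    using \<mu> assms(1) by (intro H.Hoeffding_ineq_ge) auto
  also have "\<dots> \<le> exp (- 2 * (real K / 6)\<^sup>2 / K)"
  proof -
    have "(real K / 6)\<^sup>2 \<le> (real K / 2 - \<mu>)\<^sup>2" using \<mu> by (intro power_mono) auto
    then show ?thesis by (simp add: divide_right_mono)
  qed
  also have "- 2 * (real K / 6)\<^sup>2 / K = - real K / 18"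
    using assms(1) by (simp add: power2_eq_square)
  finally show ?thesis .
qed

text \<open>Each sum depends only on the coins in the support of its coefficients, and these
  supports are disjoint blocks.\<close>

lemma indep_signed_sums:
  assumes "finite I"
    and disj: "\<And>i i' p. i \<in> L \<Longrightarrow> i' \<in> L \<Longrightarrow> i \<noteq> i' \<Longrightarrow> p \<in> I \<Longrightarrow> c i p = 0 \<or> c i' p = 0"
  shows "prob_space.indep_vars (measure_pmf (coins I)) (\<lambda>_. borel)
    (\<lambda>i. signed_sum I (c i)) L"
proof -
  define U where "U i = {p \<in> I. c i p \<noteq> 0}" for i
  have U_sub: "p \<in> I" if "p \<in> U i" for i p using that by (simp add: U_def)
  have "disjoint_family_on U L"
    using disj by (auto simp: disjoint_family_on_def U_def)
  then have "prob_space.indep_vars (measure_pmf (coins I))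
      (\<lambda>i. PiM (U i) (\<lambda>_. count_space UNIV)) (\<lambda>i f. restrict (\<lambda>p. f p) (U i)) L"
    using indep_vars_Pi_pmf[OF assms(1)]
    by (intro prob_space.indep_vars_restrict[OF measure_pmf.prob_space_axioms, where I = I]) (auto simp: U_sub)
  then have "prob_space.indep_vars (measure_pmf (coins I)) (\<lambda>_. borel)
      (\<lambda>i f. signed_sum (U i) (c i) (restrict (\<lambda>p. f p) (U i))) L"
    by (rule prob_space.indep_vars_compose2[OF measure_pmf.prob_space_axioms]) (simp add: signed_sum_def)
  moreover have "signed_sum (U i) (c i) (restrict (\<lambda>p. f p) (U i)) = signed_sum I (c i) f" for i f
    unfolding signed_sum_def using assms(1)
    by (intro sum.mono_neutral_cong_left) (auto simp: U_def)
  ultimately show ?thesis by simp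
qed

text \<open>Functions of disjoint blocks of independent variables are independent; the blocks are
  the sets \<open>G j\<close>.\<close>

lemma (in prob_space) indep_vars_groups:
  fixes X :: "nat \<Rightarrow> 'a \<Rightarrow> real"
  assumes "indep_vars (\<lambda>_. borel) X {..<K * g}"
  shows "indep_vars (\<lambda>_. borel) (\<lambda>j \<omega>. \<Sum>i<g. X (j * g + i) \<omega>) {..<K}"
proof -
  define G where "G j = {j * g..<j * g + g}" for j
  have G_less: "j * g + g \<le> j' * g" if "j < j'" for j j'
    using mult_le_mono1[of "Suc j" j' g] that by simp
  have sub: "G j \<subseteq> {..<K * g}" if "j < K" for j
    using G_less[OF that] by (auto simp: G_def)
  have disj: "disjoint_family_on G {..<K}"
    unfolding disjoint_family_on_def
  proof (intro ballI impI)
    fix j j' :: nat assume "j \<noteq> j'"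
    then consider "j < j'" | "j' < j" by linarith
    then show "G j \<inter> G j' = {}"
      by cases (use G_less in \<open>fastforce simp: G_def\<close>)+
  qed
  have "indep_vars (\<lambda>j. PiM (G j) (\<lambda>_. borel)) (\<lambda>j \<omega>. restrict (\<lambda>i. X i \<omega>) (G j)) {..<K}"
    using assms sub disj by (intro indep_vars_restrict[where I = "{..<K * g}"]) auto
  then have "indep_vars (\<lambda>_. borel) (\<lambda>j \<omega>. \<Sum>i<g. restrict (\<lambda>i. X i \<omega>) (G j) (j * g + i)) {..<K}"
    by (rule indep_vars_compose2[where Y = "\<lambda>j h. \<Sum>i<g. h (j * g + i)"])
       (auto intro!: borel_measurable_sum measurable_component_singleton simp: G_def)
  then show ?thesis by (simp add: G_def)
qed

text \<open>Each summand has variance at most \<open>(2 * w)\<^sup>2 / 8\<close>, so a group has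
  variance at most \<open>g * w\<^sup>2 / 2\<close>. The condition on \<open>d\<close> brings
  Chebyshev's bound for one group down to 1/3, and \<open>majority_indep\<close> amplifies this over
  the \<open>K\<close> independent groups.\<close>

lemma majority_of_groups_concentrated:
  fixes c :: "nat \<Rightarrow> 'i \<Rightarrow> real" and g K :: nat and w :: real
  assumes I: "finite I" and "0 < K"
    and disj: "\<And>i i' p. i < K * g \<Longrightarrow> i' < K * g \<Longrightarrow> i \<noteq> i' \<Longrightarrow> p \<in> I \<Longrightarrow>
      c i p = 0 \<or> c i' p = 0"
    and v: "\<And>i. i < K * g \<Longrightarrow> (\<Sum>p\<in>I. (c i p)\<^sup>2) \<le> 2 * w"
    and d: "0 < d" "3 * (g * w\<^sup>2 / 2) \<le> d\<^sup>2"
  shows "measure_pmf.prob (coins I) {f. K \<le> 2 * card {j. j < K \<and>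
      d \<le> \<bar>(\<Sum>i<g. (signed_sum I (c (j * g + i)) f)\<^sup>2 / 4)
        - (\<Sum>i<g. \<Sum>p\<in>I. (c (j * g + i) p)\<^sup>2) / 4\<bar>}} \<le> exp (- real K / 18)"
proof -
  define T where "T i f = (signed_sum I (c i) f)\<^sup>2 / 4" for i f
  define \<mu> where "\<mu> j = (\<Sum>i<g. \<Sum>p\<in>I. (c (j * g + i) p)\<^sup>2) / 4" for j
  note int = integrable_coins[OF I]
  have less: "j * g + i < K * g" if "j < K" "i < g" for i j
    using mult_le_mono1[of "Suc j" K g] that by simp
  have "prob_space.indep_vars (measure_pmf (coins I)) (\<lambda>_. borel) (\<lambda>i. signed_sum I (c i)) {..<K * g}"
    using disj by (intro indep_signed_sums[OF I]) auto
  then have indT: "prob_space.indep_vars (measure_pmf (coins I)) (\<lambda>_. borel) T {..<K * g}"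
    unfolding T_def by (rule prob_space.indep_vars_compose2[OF measure_pmf.prob_space_axioms]) simp
  note indG = prob_space.indep_vars_groups[OF measure_pmf.prob_space_axioms indT]
  have mean: "measure_pmf.expectation (coins I) (\<lambda>f. \<Sum>i<g. T (j * g + i) f) = \<mu> j" for j
    unfolding T_def \<mu>_def
    by (simp add: int signed_sum_second_moment[OF I] sum_divide_distrib)
  have var: "measure_pmf.variance (coins I) (\<lambda>f. \<Sum>i<g. T (j * g + i) f) \<le> g * w\<^sup>2 / 2"
    if j: "j < K" for j
  proof -
    have "prob_space.indep_vars (measure_pmf (coins I)) (\<lambda>_. borel) (\<lambda>i. T (j * g + i)) {..<g}"
      unfolding T_def
      by (rule prob_space.indep_vars_compose2[OF measure_pmf.prob_space_axioms indep_signed_sums[OF I]])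
         (use disj less[OF j] in \<open>auto\<close>)
    then have "measure_pmf.variance (coins I) (\<lambda>f. \<Sum>i<g. T (j * g + i) f) =
        (\<Sum>i<g. measure_pmf.variance (coins I) (T (j * g + i)))"
      by (intro prob_space.variance_sum_indep[OF measure_pmf.prob_space_axioms] int) auto
    also have "\<dots> \<le> (\<Sum>i<g. w\<^sup>2 / 2)"
    proof (rule sum_mono)
      fix i assume "i \<in> {..<g}"
      have "measure_pmf.variance (coins I) (T (j * g + i)) \<le> (\<Sum>p\<in>I. (c (j * g + i) p)\<^sup>2)\<^sup>2 / 8"
        unfolding T_def by (rule variance_signed_sum_squared[OF I])
      also have "(\<Sum>p\<in>I. (c (j * g + i) p)\<^sup>2)\<^sup>2 \<le> (2 * w)\<^sup>2"
        using v[OF less[OF j, of i]] \<open>i \<in> {..<g}\<close> by (intro power_mono sum_nonneg) simp_all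
      finally show "measure_pmf.variance (coins I) (T (j * g + i)) \<le> w\<^sup>2 / 2"
        by (simp add: power_mult_distrib)
    qed
    finally show ?thesis by simp
  qed
  have tail: "measure_pmf.expectation (coins I)
      (\<lambda>f. of_bool (d \<le> \<bar>(\<Sum>i<g. T (j * g + i) f) - \<mu> j\<bar>) :: real) \<le> 1/3" if j: "j < K" for j
  proof -
    have "measure_pmf.expectation (coins I) (\<lambda>f. of_bool (d \<le> \<bar>(\<Sum>i<g. T (j * g + i) f) - \<mu> j\<bar>) :: real) =
        measure_pmf.expectation (coins I) (indicator {f. d \<le> \<bar>(\<Sum>i<g. T (j * g + i) f) - \<mu> j\<bar>})"
      by (intro Bochner_Integration.integral_cong) (auto simp: indicator_def)
    also have "\<dots> = measure_pmf.prob (coins I) {f. d \<le> \<bar>(\<Sum>i<g. T (j * g + i) f) - \<mu> j\<bar>}"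
      by simp
    also have "\<dots> \<le> measure_pmf.variance (coins I) (\<lambda>f. \<Sum>i<g. T (j * g + i) f) / d\<^sup>2"
      using measure_pmf.Chebyshev_inequality[OF _ int \<open>0 < d\<close>,
          of "\<lambda>f. \<Sum>i<g. T (j * g + i) f"] by (simp add: mean)
    also have "\<dots> \<le> (d\<^sup>2 / 3) / d\<^sup>2"
      using var[OF j] d by (intro divide_right_mono) auto
    finally show ?thesis using d by simp
  qed
  have "prob_space.indep_vars (measure_pmf (coins I)) (\<lambda>_. borel)
      (\<lambda>j f. of_bool (d \<le> \<bar>(\<Sum>i<g. T (j * g + i) f) - \<mu> j\<bar>) :: real) {..<K}"
    by (rule prob_space.indep_vars_compose2[OF measure_pmf.prob_space_axioms indG]) simp
  from prob_space.majority_indep[OF measure_pmf.prob_space_axioms \<open>0 < K\<close> this tail] show ?thesis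
    by (simp add: T_def \<mu>_def)
qed

section \<open>The test given the surviving positions\<close>

lemma nths_restrict: "nths xs (I \<inter> {..<length xs}) = nths xs I"
  unfolding nths_def by (intro arg_cong[where f = "map fst"] filter_cong) (auto dest: set_zip_rightD)

text \<open>The cut at \<open>m\<close> keeps the set inside the source for every
  \<open>\<kappa>\<close>, not only for those in the support of \<open>keep_pairs q m\<close>; on
  strings of length \<open>m\<close> it does not change \<open>nths\<close>.\<close>

definition kept1 :: "nat \<Rightarrow> (nat \<Rightarrow> bool \<times> bool) \<Rightarrow> nat set" where
  "kept1 m \<kappa> = {i. fst (\<kappa> i)} \<inter> {..<m}"

definition kept2 :: "nat \<Rightarrow> (nat \<Rightarrow> bool \<times> bool) \<Rightarrow> nat set" where
  "kept2 m \<kappa> = {i. snd (\<kappa> i)} \<inter> {..<m}"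

definition regular :: "real \<Rightarrow> real \<Rightarrow> nat \<Rightarrow> nat set \<Rightarrow> nat set \<Rightarrow> bool" where
  "regular q \<delta> M A B \<longleftrightarrow> (\<forall>p\<le>M. \<bar>real (rank A p) - q * p\<bar> \<le> \<delta> \<and>
    \<bar>real (rank B p) - q * p\<bar> \<le> \<delta> \<and> \<bar>real (rank (A \<inter> B) p) - q\<^sup>2 * p\<bar> \<le> \<delta>)"

text \<open>A union bound over three events for each \<open>a\<close> from 1 to \<open>M\<close>,
  with a two-sided Hoeffding bound for each, gives the factor 6. Since \<open>a \<le> M\<close>, the
  exponent for \<open>M\<close> serves for all of them.\<close>

lemma prob_not_regular:
  assumes q: "0 < q" "q < 1" and "M \<le> m" and \<delta>: "0 \<le> \<delta>"
  shows "measure_pmf.prob (keep_pairs q m) {\<kappa>. \<not> regular q \<delta> M (kept1 m \<kappa>) (kept2 m \<kappa>)}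
    \<le> 6 * real M * exp (- 2 * \<delta>\<^sup>2 / M)"
proof -
  let ?b = "pair_pmf (bernoulli_pmf q) (bernoulli_pmf q)"
  define dev where "dev \<phi> \<rho> a = {\<kappa> :: nat \<Rightarrow> bool \<times> bool.
    \<delta> \<le> \<bar>real (card {p \<in> {..<a}. \<phi> (\<kappa> p)}) - \<rho> * real a\<bar>}" for \<phi> \<rho> a
  have prob_dev: "measure_pmf.prob (keep_pairs q m) (dev \<phi> \<rho> a) \<le> 2 * exp (- 2 * \<delta>\<^sup>2 / M)"
    if \<rho>: "measure_pmf.prob ?b {b. \<phi> b} = \<rho>" and a: "a \<in> {1..M}" for \<phi> \<rho> a
  proof -
    have "measure_pmf.prob (keep_pairs q m) (dev \<phi> \<rho> a) \<le> 2 * exp (- 2 * \<delta>\<^sup>2 / a)"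
      using Pi_pmf_Hoeffding[of "{..<m}" "{..<a}" \<delta> "(False, False)" ?b \<phi>] a \<open>M \<le> m\<close> \<delta>
      by (auto simp: keep_pairs_def dev_def \<rho> lessThan_empty_iff)
    also have "\<dots> \<le> 2 * exp (- 2 * \<delta>\<^sup>2 / M)"
      using a by (auto intro!: divide_left_mono)
    finally show ?thesis .
  qed
  have "measure_pmf.prob ?b {b. fst b} = measure_pmf.prob (map_pmf fst ?b) {True}"
    by (simp add: vimage_def)
  also have "\<dots> = q" using q by (simp add: map_fst_pair_pmf measure_pmf_single)
  finally have \<rho>1: "measure_pmf.prob ?b {b. fst b} = q" .
  have "measure_pmf.prob ?b {b. snd b} = measure_pmf.prob (map_pmf snd ?b) {True}"
    by (simp add: vimage_def)
  also have "\<dots> = q" using q by (simp add: map_snd_pair_pmf measure_pmf_single)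
  finally have \<rho>2: "measure_pmf.prob ?b {b. snd b} = q" .
  have "{b. fst b \<and> snd b} = {(True, True)}" by auto
  then have \<rho>12: "measure_pmf.prob ?b {b. fst b \<and> snd b} = q\<^sup>2"
    using q by (simp add: measure_pmf_single pmf_pair power2_eq_square)
  have "{\<kappa>. \<not> regular q \<delta> M (kept1 m \<kappa>) (kept2 m \<kappa>)} \<subseteq>
      (\<Union>a\<in>{1..M}. dev fst q a \<union> dev snd q a \<union> dev (\<lambda>b. fst b \<and> snd b) (q\<^sup>2) a)"
  proof
    fix \<kappa> assume "\<kappa> \<in> {\<kappa>. \<not> regular q \<delta> M (kept1 m \<kappa>) (kept2 m \<kappa>)}"
    then obtain a where a: "a \<le> M" and bad: "\<not> (\<bar>real (rank (kept1 m \<kappa>) a) - q * a\<bar> \<le> \<delta> \<and>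
        \<bar>real (rank (kept2 m \<kappa>) a) - q * a\<bar> \<le> \<delta> \<and>
        \<bar>real (rank (kept1 m \<kappa> \<inter> kept2 m \<kappa>) a) - q\<^sup>2 * a\<bar> \<le> \<delta>)"
      by (auto simp: regular_def)
    \<comment> \<open>Ranks at 0 vanish, so there is no deviation at 0, and the empty index set
      excluded in \<open>Pi_pmf_Hoeffding\<close> does not occur.\<close>
    have "a \<noteq> 0"
    proof
      assume "a = 0"
      with bad \<delta> show False by (simp add: rank_def)
    qed
    have sets: "kept1 m \<kappa> \<inter> {..<a} = {p \<in> {..<a}. fst (\<kappa> p)}"
         "kept2 m \<kappa> \<inter> {..<a} = {p \<in> {..<a}. snd (\<kappa> p)}"
         "kept1 m \<kappa> \<inter> kept2 m \<kappa> \<inter> {..<a} = {p \<in> {..<a}. fst (\<kappa> p) \<and> snd (\<kappa> p)}"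
      using a \<open>M \<le> m\<close> by (auto simp: kept1_def kept2_def)
    have "\<kappa> \<in> dev fst q a \<union> dev snd q a \<union> dev (\<lambda>b. fst b \<and> snd b) (q\<^sup>2) a"
      using bad unfolding dev_def rank_def sets Un_iff mem_Collect_eq by linarith
    with a \<open>a \<noteq> 0\<close> show
      "\<kappa> \<in> (\<Union>a\<in>{1..M}. dev fst q a \<union> dev snd q a \<union> dev (\<lambda>b. fst b \<and> snd b) (q\<^sup>2) a)"
      by (intro UN_I[of a]) auto
  qed
  then have "measure_pmf.prob (keep_pairs q m) {\<kappa>. \<not> regular q \<delta> M (kept1 m \<kappa>) (kept2 m \<kappa>)} \<le>
      measure_pmf.prob (keep_pairs q m)
        (\<Union>a\<in>{1..M}. dev fst q a \<union> dev snd q a \<union> dev (\<lambda>b. fst b \<and> snd b) (q\<^sup>2) a)"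
    by (intro measure_pmf.finite_measure_mono) auto
  also have "\<dots> \<le> (\<Sum>a\<in>{1..M}. measure_pmf.prob (keep_pairs q m)
        (dev fst q a \<union> dev snd q a \<union> dev (\<lambda>b. fst b \<and> snd b) (q\<^sup>2) a))"
    by (intro measure_pmf.finite_measure_subadditive_finite) auto
  also have "\<dots> \<le> (\<Sum>a\<in>{1..M}. 6 * exp (- 2 * \<delta>\<^sup>2 / M))"
  proof (rule sum_mono)
    fix a assume a: "a \<in> {1..M}"
    have "measure_pmf.prob (keep_pairs q m)
        (dev fst q a \<union> dev snd q a \<union> dev (\<lambda>b. fst b \<and> snd b) (q\<^sup>2) a) \<le>
      measure_pmf.prob (keep_pairs q m) (dev fst q a) + measure_pmf.prob (keep_pairs q m) (dev snd q a)
      + measure_pmf.prob (keep_pairs q m) (dev (\<lambda>b. fst b \<and> snd b) (q\<^sup>2) a)"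
      by (intro order_trans[OF measure_Un_le] add_mono measure_Un_le order_refl) auto
    also have "\<dots> \<le> 6 * exp (- 2 * \<delta>\<^sup>2 / M)"
      using prob_dev[OF \<rho>1 a] prob_dev[OF \<rho>2 a] prob_dev[OF \<rho>12 a] by linarith
    finally show "measure_pmf.prob (keep_pairs q m)
        (dev fst q a \<union> dev snd q a \<union> dev (\<lambda>b. fst b \<and> snd b) (q\<^sup>2) a)
        \<le> 6 * exp (- 2 * \<delta>\<^sup>2 / M)" .
  qed
  finally show ?thesis by (simp add: mult_ac)
qed

section \<open>Window differences as signed sums\<close>

lemma difference_eq_signed_sum:
  fixes f :: "'i \<Rightarrow> bool"
  assumes "finite I" "P \<subseteq> I" "Q \<subseteq> I" "card P = card Q"
  defines "c \<equiv> \<lambda>p. of_bool (p \<in> P) - of_bool (p \<in> Q) :: real"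
  shows "(\<Sum>p\<in>P. of_bool (f p)) - (\<Sum>p\<in>Q. of_bool (f p)) = signed_sum I c f / 2"
    and "(\<Sum>p\<in>I. (c p)\<^sup>2) = real (card P) + real (card Q) - 2 * real (card (P \<inter> Q))"
proof -
  have ind: "(\<Sum>p\<in>R. h p) = (\<Sum>p\<in>I. of_bool (p \<in> R) * h p)" if "R \<subseteq> I" for R and h :: "'i \<Rightarrow> real"
    using assms(1) that by (intro sum.mono_neutral_cong_left) auto
  have card: "real (card R) = (\<Sum>p\<in>I. of_bool (p \<in> R))" if "R \<subseteq> I" for R
    using ind[OF that, of "\<lambda>_. 1"] by simp
  \<comment> \<open>A bit is half of one plus its sign. Equal cardinalities make the coefficients
    sum to 0, so no constant term remains.\<close>
  have "(\<Sum>p\<in>I. c p) = 0"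
    using card[OF assms(2)] card[OF assms(3)] assms(4) by (simp add: c_def sum_subtractf)
  then have "signed_sum I c f / 2 = (\<Sum>p\<in>I. c p * (if f p then 1 else - 1) + c p) / 2"
    by (simp add: signed_sum_def sum.distrib)
  also have "\<dots> = (\<Sum>p\<in>I. c p * of_bool (f p))"
    by (simp add: sum_divide_distrib) (intro sum.cong; simp)
  also have "\<dots> = (\<Sum>p\<in>P. of_bool (f p)) - (\<Sum>p\<in>Q. of_bool (f p))"
    unfolding ind[OF assms(2)] ind[OF assms(3)] by (simp add: c_def left_diff_distrib sum_subtractf)
  finally show "(\<Sum>p\<in>P. of_bool (f p)) - (\<Sum>p\<in>Q. of_bool (f p)) = signed_sum I c f / 2" ..
  have "P \<inter> Q \<subseteq> I" using assms(2) by auto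
  \<comment> \<open>The squared coefficient is the indicator of the symmetric difference of
    \<open>P\<close> and \<open>Q\<close>.\<close>
  have "(\<Sum>p\<in>I. (c p)\<^sup>2) =
      (\<Sum>p\<in>I. of_bool (p \<in> P) + of_bool (p \<in> Q) - 2 * of_bool (p \<in> P \<inter> Q))"
    by (intro sum.cong) (auto simp: c_def)
  then show "(\<Sum>p\<in>I. (c p)\<^sup>2) = real (card P) + real (card Q) - 2 * real (card (P \<inter> Q))"
    unfolding card[OF assms(2)] card[OF assms(3)] card[OF \<open>P \<inter> Q \<subseteq> I\<close>]
    by (simp add: sum.distrib sum_subtractf sum_distrib_left)
qed

text \<open>Transfers \<open>majority_of_groups_concentrated\<close> to bit counts. The mean of a
  squared difference is a quarter of the sum of squared coefficients, which is
  \<open>2 * w - 2 * card (P i \<inter> Q i)\<close>; disjoint windows give coefficients with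
  disjoint supports.\<close>

lemma majority_of_differences_concentrated:
  fixes P Q :: "nat \<Rightarrow> 'i set" and g K w :: nat and d :: real
  assumes I: "finite I" and "0 < K"
    and P: "\<And>i. i < K * g \<Longrightarrow> P i \<subseteq> I \<and> card (P i) = w"
    and Q: "\<And>i. i < K * g \<Longrightarrow> Q i \<subseteq> I \<and> card (Q i) = w"
    and disj: "\<And>i i'. i < K * g \<Longrightarrow> i' < K * g \<Longrightarrow> i \<noteq> i' \<Longrightarrow> (P i \<union> Q i) \<inter> (P i' \<union> Q i') = {}"
    and d: "0 < d" "3 * (g * (real w)\<^sup>2 / 2) \<le> d\<^sup>2"
  shows "measure_pmf.prob (coins I) {f. K \<le> 2 * card {j. j < K \<and>
      d \<le> \<bar>(\<Sum>i<g. ((\<Sum>p\<in>P (j * g + i). of_bool (f p)) - (\<Sum>p\<in>Q (j * g + i). of_bool (f p)))\<^sup>2)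
        - (\<Sum>i<g. (real w - card (P (j * g + i) \<inter> Q (j * g + i))) / 2)\<bar>}} \<le> exp (- real K / 18)"
proof -
  define c where "c i p = (of_bool (p \<in> P i) - of_bool (p \<in> Q i) :: real)" for i p
  have diff: "(\<Sum>p\<in>P i. of_bool (f p)) - (\<Sum>p\<in>Q i. of_bool (f p)) = signed_sum I (c i) f / 2"
    and sq: "(\<Sum>p\<in>I. (c i p)\<^sup>2) = 2 * real w - 2 * real (card (P i \<inter> Q i))"
    if "i < K * g" for i f
    using difference_eq_signed_sum[OF I, of "P i" "Q i"] P[OF that] Q[OF that]
    by (simp_all add: c_def[abs_def])
  have less: "j * g + i < K * g" if "j < K" "i < g" for i j
    using mult_le_mono1[of "Suc j" K g] that by simp
  have "{j. j < K \<and> d \<le> \<bar>(\<Sum>i<g. ((\<Sum>p\<in>P (j * g + i). of_bool (f p))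
          - (\<Sum>p\<in>Q (j * g + i). of_bool (f p)))\<^sup>2)
        - (\<Sum>i<g. (real w - card (P (j * g + i) \<inter> Q (j * g + i))) / 2)\<bar>} =
      {j. j < K \<and> d \<le> \<bar>(\<Sum>i<g. (signed_sum I (c (j * g + i)) f)\<^sup>2 / 4)
        - (\<Sum>i<g. \<Sum>p\<in>I. (c (j * g + i) p)\<^sup>2) / 4\<bar>}" for f
    using less
    by (intro Collect_cong conj_cong refl)
       (simp add: diff sq sum_divide_distrib diff_divide_distrib power_divide)
  moreover have "measure_pmf.prob (coins I) {f. K \<le> 2 * card {j. j < K \<and>
      d \<le> \<bar>(\<Sum>i<g. (signed_sum I (c (j * g + i)) f)\<^sup>2 / 4)
        - (\<Sum>i<g. \<Sum>p\<in>I. (c (j * g + i) p)\<^sup>2) / 4\<bar>}} \<le> exp (- real K / 18)"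
  proof (rule majority_of_groups_concentrated[OF I \<open>0 < K\<close> _ _ d])
    show "c i p = 0 \<or> c i' p = 0" if "i < K * g" "i' < K * g" "i \<noteq> i'" "p \<in> I" for i i' p
      using disj[OF that(1-3)] by (auto simp: c_def)
    show "(\<Sum>p\<in>I. (c i p)\<^sup>2) \<le> 2 * real w" if "i < K * g" for i
      by (simp add: sq[OF that])
  qed
  ultimately show ?thesis by simp
qed

lemma length_filter_group_sums:
  "length (filter R (map z [0..<K])) = card {j. j < K \<and> R (z j)}"
  by (simp add: length_filter_conv_card) (rule arg_cong[where f = card]; auto)

text \<open>The threshold \<open>\<theta>\<close> is \<open>g * w / 2 - d\<close> with
  \<open>d = q * g * w / 8\<close>. Given regular survivors, the mean of a group sum is at most
  \<open>\<theta> - d\<close> for a common source and equals \<open>\<theta> + d\<close> for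
  independent ones, so a group sum on the wrong side deviates by at least \<open>d\<close>.\<close>

lemma prob_D_wrong_side_given_kept:
  fixes q :: real and w g N M m :: nat
  defines "K \<equiv> Suc N" and "\<theta> \<equiv> (1 - q/4) * real g * real w / 2"
  assumes q: "0 < q" "q < 1" and w: "10 \<le> q * w" and g: "96 \<le> q\<^sup>2 * g"
    and M: "M \<le> m" "2 * real w * (K * g) + q * w / 10 \<le> q * M"
    and reg: "regular q (q * w / 10) M A B" and A: "A \<subseteq> {..<m}" "B \<subseteq> {..<m}"
  shows "measure_pmf.prob (coins {..<m})
      {f. \<not> D w g N (nths (map f [0..<m]) A) (nths (map f [0..<m]) B) < \<theta>} \<le> exp (- real K / 18)"
    and "measure_pmf.prob (coins {..<m + m})
      {f. \<not> D w g N (nths (map f [0..<m]) A) (nths (map f [m..<m + m]) B) \<ge> \<theta>} \<le> exp (- real K / 18)"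
proof -
  define P where "P = window_positions w A"
  define Q where "Q = window_positions w B"
  define d where "d = q * g * w / 8"
  have fin: "finite A" "finite B" using A finite_subset by auto
  have gw: "0 < real g" "0 < real w" using g w q by (auto intro!: Nat.gr0I)
  have d: "0 < d" "3 * (g * (real w)\<^sup>2 / 2) \<le> d\<^sup>2"
  proof -
    show "0 < d" using q gw by (simp add: d_def)
    \<comment> \<open>Source of the constant 96:
      \<open>d\<^sup>2 = q\<^sup>2 * g\<^sup>2 * w\<^sup>2 / 64\<close> is at least
      \<open>96 / 64 = 3 / 2\<close> times \<open>g * w\<^sup>2\<close>.\<close>
    have "96 * (g * (real w)\<^sup>2) \<le> (q\<^sup>2 * g) * (g * (real w)\<^sup>2)"
      using g by (intro mult_right_mono) auto
    then show "3 * (g * (real w)\<^sup>2 / 2) \<le> d\<^sup>2"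
      by (simp add: d_def power2_eq_square algebra_simps)
  qed
  have less: "j * g + i < K * g" if "j < K" "i < g" for i j
    using mult_le_mono1[of "Suc j" K g] that by simp
  have V: "2 * w * i + w \<le> 2 * w * (K * g)" if "i < K * g" for i
    using mult_le_mono2[of "Suc i" "K * g" "2 * w"] that by simp
  have closeA: "\<bar>real (rank A p) - q * p\<bar> \<le> q * w / 10" if "p \<le> M" for p
    using reg that by (simp add: regular_def)
  have closeB: "\<bar>real (rank B p) - q * p\<bar> \<le> q * w / 10" if "p \<le> M" for p
    using reg that by (simp add: regular_def)
  have closeAB: "\<bar>real (rank (A \<inter> B) p) - q\<^sup>2 * p\<bar> \<le> q * w / 10" if "p \<le> M" for p
    using reg that by (simp add: regular_def)
  \<comment> \<open>All \<open>K * g\<close> windows end by trace position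
    \<open>2 * w * (K * g)\<close>, so the first \<open>M\<close> source positions fill them in both
    traces.\<close>
  have "real (2 * w * (K * g)) \<le> real (rank A M)"
    using closeA[of M] M(2) unfolding of_nat_mult of_nat_numeral by linarith
  then have rankA: "2 * w * (K * g) \<le> rank A M" by (simp only: of_nat_le_iff)
  have "real (2 * w * (K * g)) \<le> real (rank B M)"
    using closeB[of M] M(2) unfolding of_nat_mult of_nat_numeral by linarith
  then have rankB: "2 * w * (K * g) \<le> rank B M" by (simp only: of_nat_le_iff)
  have "rank A M \<le> card A" "rank B M \<le> card B"
    unfolding rank_def using fin by (auto intro: card_mono)
  then have cardP: "card (P i) = w" and cardQ: "card (Q i) = w" if "i < K * g" for i
    unfolding P_def Q_def using V[OF that] rankA rankB fin
    by (auto intro!: card_window_positions)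
  have sub: "P i \<subseteq> A" "Q i \<subseteq> B" for i
    by (auto simp: P_def Q_def window_positions_def)
  have PQ: "p < m" if "p \<in> P i \<or> p \<in> Q i" for p i using that sub[of i] A by auto
  have window1: "window_sum w (nths (map f [0..<m]) A) i = (\<Sum>p\<in>P i. of_bool (f p))" for f i
    using A PQ[of _ i] unfolding P_def
    by (subst window_sum_nths) (auto intro!: sum.cong)
  have window2: "window_sum w (nths (map f [a..<a + m]) B) i = (\<Sum>p\<in>Q i. of_bool (f (a + p)))" for f a i
    using A PQ[of _ i] unfolding Q_def
    by (subst window_sum_nths) (auto intro!: sum.cong)
  have qw: "2 * (q * w / 10) \<le> w" using mult_left_le_one_le[of "real w" q] q by simp
  have AB: "\<bar>real (rank A p) - real (rank B p)\<bar> \<le> w" if "p \<le> M" for p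
    using closeA[OF that] closeB[OF that] qw by linarith
  have disj: "(P i \<union> Q i) \<inter> (P i' \<union> Q i') = {}"
    if "i < K * g" "i' < K * g" "i \<noteq> i'" for i i'
  proof -
    have "P i \<inter> P i' = {}" unfolding P_def
      using V that rankA by (intro window_positions_disjoint[where V = "2 * w * (K * g)" and M = M]) auto
    moreover have "Q i \<inter> Q i' = {}" unfolding Q_def
      using V that rankB by (intro window_positions_disjoint[where V = "2 * w * (K * g)" and M = M]) auto
    moreover have "P i \<inter> Q i' = {}"
      unfolding P_def Q_def by (rule window_positions_disjoint[OF AB rankA V[OF that(1)] that(3)])
    moreover have "P i' \<inter> Q i = {}"
      unfolding P_def Q_def
      by (rule window_positions_disjoint[OF AB rankA V[OF that(2)] not_sym[OF that(3)]])
    ultimately show ?thesis by blast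
  qed
  have overlap: "q * w / 2 \<le> card (P i \<inter> Q i)" if "i < K * g" for i
    unfolding P_def Q_def
  proof (rule window_positions_overlap[where M = M])
    have "real (2 * w * i + w) \<le> real (2 * w * (K * g))"
      using V[OF that] by (simp only: of_nat_le_iff)
    moreover have "0 \<le> q * w / 10" using q by simp
    ultimately show "2 * real w * i + w \<le> q * M"
      using M(2) unfolding of_nat_mult of_nat_add of_nat_numeral by linarith
  qed (use q fin w closeA closeB closeAB in auto)

  show "measure_pmf.prob (coins {..<m})
      {f. \<not> D w g N (nths (map f [0..<m]) A) (nths (map f [0..<m]) B) < \<theta>} \<le> exp (- real K / 18)"
  proof -
    define z where "z f j = (\<Sum>i<g. ((\<Sum>p\<in>P (j * g + i). of_bool (f p))
      - (\<Sum>p\<in>Q (j * g + i). of_bool (f p)))\<^sup>2 :: real)" for f :: "nat \<Rightarrow> bool" and j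
    define \<mu> where "\<mu> j = (\<Sum>i<g. (real w - card (P (j * g + i) \<inter> Q (j * g + i))) / 2)" for j
    have z: "group_sum w g (nths (map f [0..<m]) A) (nths (map f [0..<m]) B) = z f" for f
      unfolding group_sum_def Z_def z_def
      using window2[of f 0] by (simp add: window1)
    have \<mu>: "\<mu> j \<le> (1 - q/2) * g * w / 2" if "j < K" for j
    proof -
      have "\<mu> j \<le> (\<Sum>i<g. (real w - q * w / 2) / 2)"
        unfolding \<mu>_def using overlap[OF less[OF that]] by (intro sum_mono) auto
      also have "\<dots> = (1 - q/2) * g * w / 2" by (simp add: algebra_simps)
      finally show ?thesis .
    qed
    \<comment> \<open>If the median fails, at least half of the group sums are on the wrong side,
      and each of those deviates by at least \<open>d\<close>.\<close>
    have "{f. \<not> D w g N (nths (map f [0..<m]) A) (nths (map f [0..<m]) B) < \<theta>} \<subseteq>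
        {f. K \<le> 2 * card {j. j < K \<and> d \<le> \<bar>z f j - \<mu> j\<bar>}}"
    proof clarify
      fix f assume "\<not> D w g N (nths (map f [0..<m]) A) (nths (map f [0..<m]) B) < \<theta>"
      then have "K \<le> 2 * card {j. j < K \<and> \<theta> \<le> z f j}"
        using median_less[of \<theta> "map (z f) [0..<K]"]
        unfolding D_def z K_def[symmetric] length_filter_group_sums by fastforce
      also have "card {j. j < K \<and> \<theta> \<le> z f j} \<le> card {j. j < K \<and> d \<le> \<bar>z f j - \<mu> j\<bar>}"
      proof (intro card_mono subsetI CollectI conjI; (elim CollectE conjE)?)
        fix j assume "j < K" "\<theta> \<le> z f j"
        moreover have "\<theta> = (1 - q/2) * g * w / 2 + d"
          by (simp add: \<theta>_def d_def field_simps)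
        ultimately show "d \<le> \<bar>z f j - \<mu> j\<bar>" using \<mu>[of j] by linarith
      qed auto
      finally show "K \<le> 2 * card {j. j < K \<and> d \<le> \<bar>z f j - \<mu> j\<bar>}" by simp
    qed
    then have "measure_pmf.prob (coins {..<m})
        {f. \<not> D w g N (nths (map f [0..<m]) A) (nths (map f [0..<m]) B) < \<theta>} \<le>
      measure_pmf.prob (coins {..<m}) {f. K \<le> 2 * card {j. j < K \<and> d \<le> \<bar>z f j - \<mu> j\<bar>}}"
      by (intro measure_pmf.finite_measure_mono) auto
    also have "\<dots> \<le> exp (- real K / 18)"
      unfolding z_def \<mu>_def
    proof (rule majority_of_differences_concentrated)
      show "P i \<subseteq> {..<m} \<and> card (P i) = w" "Q i \<subseteq> {..<m} \<and> card (Q i) = w"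
        if "i < K * g" for i
        using PQ cardP[OF that] cardQ[OF that] by blast+
      show "(P i \<union> Q i) \<inter> (P i' \<union> Q i') = {}" if "i < K * g" "i' < K * g" "i \<noteq> i'" for i i'
        using that by (rule disj)
    qed (use d in \<open>auto simp: K_def\<close>)
    finally show ?thesis .
  qed

  show "measure_pmf.prob (coins {..<m + m})
      {f. \<not> D w g N (nths (map f [0..<m]) A) (nths (map f [m..<m + m]) B) \<ge> \<theta>} \<le> exp (- real K / 18)"
  proof -
    \<comment> \<open>The second source occupies the coins from \<open>m\<close> on. The shifted
      windows miss those of the first trace, so the overlap is 0 and every group mean is
      \<open>g * w / 2\<close>.\<close>
    define Q' where "Q' i = (\<lambda>p. m + p) ` Q i" for i
    define z where "z f j = (\<Sum>i<g. ((\<Sum>p\<in>P (j * g + i). of_bool (f p))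
      - (\<Sum>p\<in>Q' (j * g + i). of_bool (f p)))\<^sup>2 :: real)" for f :: "nat \<Rightarrow> bool" and j
    define \<mu> where "\<mu> j = (\<Sum>i<g. (real w - card (P (j * g + i) \<inter> Q' (j * g + i))) / 2)" for j
    have cardQ': "card (Q' i) = card (Q i)" for i
      unfolding Q'_def by (intro card_image) auto
    have PQ': "P i \<inter> Q' i' = {}" for i i' using PQ by (auto simp: Q'_def)
    have z: "group_sum w g (nths (map f [0..<m]) A) (nths (map f [m..<m + m]) B) = z f" for f
      unfolding group_sum_def Z_def z_def Q'_def by (simp add: window1 window2 sum.reindex)
    have \<mu>: "\<mu> j = g * w / 2" for j
      by (simp add: \<mu>_def PQ')
    have "{f. \<not> D w g N (nths (map f [0..<m]) A) (nths (map f [m..<m + m]) B) \<ge> \<theta>} \<subseteq>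
        {f. K \<le> 2 * card {j. j < K \<and> d \<le> \<bar>z f j - \<mu> j\<bar>}}"
    proof clarify
      fix f assume "\<not> D w g N (nths (map f [0..<m]) A) (nths (map f [m..<m + m]) B) \<ge> \<theta>"
      then have "K \<le> 2 * card {j. j < K \<and> z f j < \<theta>}"
        using median_ge[of \<theta> "map (z f) [0..<K]"]
        unfolding D_def z K_def[symmetric] length_filter_group_sums by fastforce
      also have "card {j. j < K \<and> z f j < \<theta>} \<le> card {j. j < K \<and> d \<le> \<bar>z f j - \<mu> j\<bar>}"
      proof (intro card_mono subsetI CollectI conjI; (elim CollectE conjE)?)
        fix j assume "j < K" "z f j < \<theta>"
        moreover have "\<theta> = g * w / 2 - d"
          by (simp add: \<theta>_def d_def field_simps)
        ultimately show "d \<le> \<bar>z f j - \<mu> j\<bar>" using \<mu>[of j] by linarith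
      qed auto
      finally show "K \<le> 2 * card {j. j < K \<and> d \<le> \<bar>z f j - \<mu> j\<bar>}" by simp
    qed
    then have "measure_pmf.prob (coins {..<m + m})
        {f. \<not> D w g N (nths (map f [0..<m]) A) (nths (map f [m..<m + m]) B) \<ge> \<theta>} \<le>
      measure_pmf.prob (coins {..<m + m}) {f. K \<le> 2 * card {j. j < K \<and> d \<le> \<bar>z f j - \<mu> j\<bar>}}"
      by (intro measure_pmf.finite_measure_mono) auto
    also have "\<dots> \<le> exp (- real K / 18)"
      unfolding z_def \<mu>_def
    proof (rule majority_of_differences_concentrated)
      show "P i \<subseteq> {..<m + m} \<and> card (P i) = w" if "i < K * g" for i
        using PQ cardP[OF that] by (auto intro: trans_less_add1)
      show "Q' i \<subseteq> {..<m + m} \<and> card (Q' i) = w" if "i < K * g" for i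
        using PQ[of _ i] cardQ[OF that] cardQ' by (auto simp: Q'_def)
      show "(P i \<union> Q' i) \<inter> (P i' \<union> Q' i') = {}" if "i < K * g" "i' < K * g" "i \<noteq> i'" for i i'
        using disj[OF that] PQ'[of i i'] PQ'[of i' i] by (auto simp: Q'_def)
    qed (use d in \<open>auto simp: K_def\<close>)
    finally show ?thesis .
  qed
qed

section \<open>Choice of parameters\<close>

lemma prob_compl_ge:
  assumes "measure_pmf.prob p {\<omega>. \<not> R \<omega>} \<le> \<epsilon>"
  shows "1 - \<epsilon> \<le> measure_pmf.prob p {\<omega>. R \<omega>}"
proof -
  have "{\<omega>. R \<omega>} = space (measure_pmf p) - {\<omega>. \<not> R \<omega>}" by auto
  then show ?thesis using assms by (simp only: measure_pmf.prob_compl sets_measure_pmf UNIV_I diff_left_mono)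
qed

text \<open>The first term of \<open>\<epsilon>\<close> pays for irregular survivors, the second for
  a wrong median given regular ones.\<close>

lemma prob_D_bounds:
  fixes q :: real and w g N M m :: nat
  defines "K \<equiv> Suc N" and "\<theta> \<equiv> (1 - q/4) * real g * real w / 2"
  assumes q: "0 < q" "q < 1" and w: "10 \<le> q * w" and g: "96 \<le> q\<^sup>2 * g"
    and M: "M \<le> m" "2 * real w * (K * g) + q * w / 10 \<le> q * M"
  defines "\<epsilon> \<equiv> 6 * real M * exp (- 2 * (q * w / 10)\<^sup>2 / M) + exp (- real K / 18)"
  shows "1 - \<epsilon> \<le> measure_pmf.prob (traces_same_source q m) {(t, t'). D w g N t t' < \<theta>}"
    and "1 - \<epsilon> \<le> measure_pmf.prob (traces_indep_sources q m) {(t, t'). D w g N t t' \<ge> \<theta>}"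
proof -
  let ?A = "kept1 m" and ?B = "kept2 m"
  let ?G = "\<lambda>\<kappa>. regular q (q * w / 10) M (?A \<kappa>) (?B \<kappa>)"
  have bad: "measure_pmf.prob (keep_pairs q m) {\<kappa>. \<not> ?G \<kappa>}
      \<le> 6 * real M * exp (- 2 * (q * w / 10)\<^sup>2 / M)"
    using q by (intro prob_not_regular M) auto
  have AB: "?A \<kappa> \<subseteq> {..<m}" "?B \<kappa> \<subseteq> {..<m}" for \<kappa> by (auto simp: kept1_def kept2_def)
  note tail = prob_D_wrong_side_given_kept[OF q w g M(1) M(2)[unfolded K_def] _ AB, folded K_def \<theta>_def]
  have nths1: "nths (map f [a..<a + m]) {i. fst (\<kappa> i)} = nths (map f [a..<a + m]) (?A \<kappa>)"
    and nths2: "nths (map f [a..<a + m]) {i. snd (\<kappa> i)} = nths (map f [a..<a + m]) (?B \<kappa>)"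
    for \<kappa> a and f :: "nat \<Rightarrow> bool"
    using nths_restrict[of "map f [a..<a + m]"] by (simp_all add: kept1_def kept2_def)

  have "measure_pmf.prob (traces_same_source q m) {t. \<not> (case t of (t, t') \<Rightarrow> D w g N t t' < \<theta>)} \<le> \<epsilon>"
    unfolding traces_same_source_eq \<epsilon>_def
  proof (rule prob_bind_pmf_le[OF bad])
    fix \<kappa> assume "?G \<kappa>"
    from tail(1)[OF this] show "measure_pmf.prob (map_pmf
        (\<lambda>x. (nths x {i. fst (\<kappa> i)}, nths x {i. snd (\<kappa> i)})) (random_string m))
        {t. \<not> (case t of (t, t') \<Rightarrow> D w g N t t' < \<theta>)} \<le> exp (- real K / 18)"
      using nths1[of _ 0 \<kappa>] nths2[of _ 0 \<kappa>]
      by (simp add: random_string_eq_coins vimage_def)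
  qed simp
  from prob_compl_ge[OF this]
  show "1 - \<epsilon> \<le> measure_pmf.prob (traces_same_source q m) {(t, t'). D w g N t t' < \<theta>}" .

  have "measure_pmf.prob (traces_indep_sources q m) {t. \<not> (case t of (t, t') \<Rightarrow> D w g N t t' \<ge> \<theta>)} \<le> \<epsilon>"
    unfolding traces_indep_sources_eq \<epsilon>_def
  proof (rule prob_bind_pmf_le[OF bad])
    fix \<kappa> assume "?G \<kappa>"
    from tail(2)[OF this] show "measure_pmf.prob (map_pmf
        (\<lambda>z. (nths (take m z) {i. fst (\<kappa> i)}, nths (drop m z) {i. snd (\<kappa> i)})) (random_string (m + m)))
        {t. \<not> (case t of (t, t') \<Rightarrow> D w g N t t' \<ge> \<theta>)} \<le> exp (- real K / 18)"
      using nths1[of _ 0 \<kappa>] nths2[of _ m \<kappa>]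
      by (simp add: random_string_eq_coins vimage_def take_map drop_map)
  qed simp
  from prob_compl_ge[OF this]
  show "1 - \<epsilon> \<le> measure_pmf.prob (traces_indep_sources q m) {(t, t'). D w g N t t' \<ge> \<theta>}" .
qed

text \<open>Here \<open>u\<close> is the unrounded window width, \<open>C * ln n + 1\<close> will
  bound the number of groups, and its product with \<open>u + 1\<close> and \<open>L\<close> the
  source prefix \<open>M\<close>. The prefix fits into the string since n^(1/4) times a power of log
  n is below sqrt n; the last condition makes the Hoeffding exponent at least
  \<open>13 * ln n\<close>.\<close>

lemma eventually_parameters:
  fixes q C L :: real
  assumes "0 < q" "0 < C" "0 < L"
  defines "u \<equiv> \<lambda>n. 100 * real n powr (1/4) * sqrt ((1/q) * ln (real n))"
  shows "\<forall>\<^sub>F n in at_top. 3 \<le> n \<and> 10 \<le> q * u n \<and>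
    (u n + 1) * (C * ln (real n) + 1) * L \<le> sqrt (real n) - 1 \<and>
    13 * ln (real n) * ((C * ln (real n) + 1) * L) \<le> q\<^sup>2 * u n / 50"
proof (intro eventually_conj)
  show "\<forall>\<^sub>F n in at_top. 3 \<le> (n::nat)" by (rule eventually_ge_at_top)
  show "\<forall>\<^sub>F n in at_top. 10 \<le> q * u n"
    unfolding u_def using assms(1-3) by real_asymp
  show "\<forall>\<^sub>F n in at_top. (u n + 1) * (C * ln (real n) + 1) * L \<le> sqrt (real n) - 1"
    unfolding u_def using assms(1-3) by real_asymp
  show "\<forall>\<^sub>F n in at_top. 13 * ln (real n) * ((C * ln (real n) + 1) * L) \<le> q\<^sup>2 * u n / 50"
    unfolding u_def using assms(1-3) by real_asymp
qed

text \<open>The constant \<open>c\<close>, chosen before \<open>N\<close>, makes the lower half of N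
  = Theta(log n) explicit: it has to be large enough for the majority bound to fall below 1/n^10.
  The upper half keeps the number of windows O(log n).\<close>

theorem theorem13:
  fixes q :: real
  assumes "0 < q" and "q < 1"
  shows "\<exists>c>0. \<forall>N :: nat \<Rightarrow> nat.
    (\<lambda>n. real (N n)) \<in> \<Theta>(\<lambda>n. ln (real n)) \<longrightarrow>
    (\<forall>\<^sub>F n in at_top. real (N n) \<ge> c * ln (real n)) \<longrightarrow>
    (\<forall>\<^sub>F n in at_top.
       (let m = string_length n; w = window_width q n; g = group_size q;
            \<theta> = (1 - q/4) * real g * real w / 2
        in measure_pmf.prob (traces_same_source q m)
             {(t, t'). D w g (N n) t t' < \<theta>} \<ge> 1 - 1 / real n ^ 10
         \<and> measure_pmf.prob (traces_indep_sources q m)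
             {(t, t'). D w g (N n) t t' \<ge> \<theta>} \<ge> 1 - 1 / real n ^ 10))"
\<comment> \<open>\<open>198 = 11 * 18\<close> turns the tail bound \<open>exp (- (N + 1) / 18)\<close> into \<open>1 / n^11\<close>.\<close>
proof (intro exI[of _ "198::real"] conjI allI impI)
  fix N :: "nat \<Rightarrow> nat"
  assume \<Theta>: "(\<lambda>n. real (N n)) \<in> \<Theta>(\<lambda>n. ln (real n))"
    and lower: "\<forall>\<^sub>F n in at_top. real (N n) \<ge> 198 * ln (real n)"
  obtain C where C: "0 < C" "\<forall>\<^sub>F n in at_top. norm (real (N n)) \<le> C * norm (ln (real n))"
    using landau_o.bigE[OF bigthetaD1[OF \<Theta>]] by blast
  define g where "g = group_size q"
  have g: "96 \<le> q\<^sup>2 * g"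
  proof -
    have "96 / q\<^sup>2 \<le> g" unfolding g_def group_size_def by linarith
    then show ?thesis using assms by (simp add: field_simps)
  qed
  then have g1: "1 \<le> real g" using assms by (cases g) auto
  \<comment> \<open>Chosen so that \<open>M \<le> w * K * L\<close>: \<open>2 / q\<close> comes from
    the main term of \<open>M\<close>, and the summand 2 absorbs \<open>w / 10\<close> and the
    rounding, each at most \<open>w * (K * g)\<close>.\<close>
  define L where "L = g * (2 / q + 2)"
  have "0 < L" using g1 assms by (auto simp: L_def intro!: mult_pos_pos add_pos_pos)
  show "\<forall>\<^sub>F n in at_top.
       (let m = string_length n; w = window_width q n; g = group_size q;
            \<theta> = (1 - q/4) * real g * real w / 2
        in measure_pmf.prob (traces_same_source q m)
             {(t, t'). D w g (N n) t t' < \<theta>} \<ge> 1 - 1 / real n ^ 10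
         \<and> measure_pmf.prob (traces_indep_sources q m)
             {(t, t'). D w g (N n) t t' \<ge> \<theta>} \<ge> 1 - 1 / real n ^ 10)"
    using lower C(2) eventually_parameters[OF \<open>0 < q\<close> \<open>0 < C\<close> \<open>0 < L\<close>]
  proof eventually_elim
    case (elim n)
    define u where "u = 100 * real n powr (1/4) * sqrt ((1/q) * ln (real n))"
    define w where "w = window_width q n"
    define m where "m = string_length n"
    define K where "K = Suc (N n)"
    \<comment> \<open>The least natural number that satisfies the prefix condition of
      \<open>prob_D_bounds\<close>.\<close>
    define M where "M = nat \<lceil>(2 * real w * (K * g) + q * w / 10) / q\<rceil>"
    have n: "3 \<le> real n" and u: "10 \<le> q * u"
      and ub: "(u + 1) * (C * ln n + 1) * L \<le> sqrt n - 1"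
      and lb: "13 * ln n * ((C * ln n + 1) * L) \<le> q\<^sup>2 * u / 50"
      using elim(3) by (auto simp: u_def)
    have lnn: "0 < ln (real n)" using n by simp
    have u0: "0 \<le> u" unfolding u_def using lnn assms by simp
    have w: "u \<le> w" "w \<le> u + 1"
      using u0 unfolding w_def window_width_def u_def by linarith+
    have qw: "10 \<le> q * w" using u mult_left_mono[OF w(1) less_imp_le[OF assms(1)]] by linarith
    have w1: "1 \<le> real w" using qw by (cases w) auto
    have K: "198 * ln n \<le> K" "K \<le> C * ln n + 1" "1 \<le> real K"
      using elim(1,2) lnn by (auto simp: K_def)
    have M_lower: "2 * real w * (K * g) + q * w / 10 \<le> q * M"
    proof -
      have "(2 * real w * (K * g) + q * w / 10) / q \<le> M" unfolding M_def by linarith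
      then show ?thesis using assms by (simp add: field_simps)
    qed
    have "w \<le> w * (K * g)" "1 \<le> w * (K * g)"
      using w1 K(3) g1 by (auto intro: Suc_leI)
    then have wKg: "real w \<le> real w * (K * g)" "1 \<le> real w * (K * g)"
      by (metis of_nat_le_iff of_nat_mult, metis of_nat_1 of_nat_le_iff of_nat_mult)
    have M_upper: "real M \<le> w * K * L"
    proof -
      have "0 \<le> (2 * real w * (K * g) + q * w / 10) / q" using assms by simp
      then have "real M \<le> (2 * real w * (K * g) + q * w / 10) / q + 1"
        unfolding M_def by linarith
      also have "\<dots> = 2 / q * (real w * (K * g)) + real w / 10 + 1"
        using assms by (simp add: field_simps)
      also have "\<dots> \<le> 2 / q * (real w * (K * g)) + real w * (K * g) + real w * (K * g)"
        using wKg by linarith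
      also have "\<dots> = w * K * L" by (simp add: L_def algebra_simps)
      finally show ?thesis .
    qed
    have M0: "0 < real M"
    proof -
      have "0 < q * M" using M_lower w1 K(3) g1 assms qw
        by (smt (verit) divide_pos_pos mult_nonneg_nonneg of_nat_0_le_iff)
      then show ?thesis using assms by (simp add: zero_less_mult_iff)
    qed
    have "real w * K \<le> (u + 1) * (C * ln n + 1)"
      using w(2) K(2) u0 by (intro mult_mono) auto
    then have "real w * K * L \<le> (u + 1) * (C * ln n + 1) * L"
      using \<open>0 < L\<close> by (intro mult_right_mono) auto
    then have "real M \<le> (u + 1) * (C * ln n + 1) * L"
      using M_upper by simp
    \<comment> \<open>The 1 pays for rounding sqrt n down in \<open>string_length\<close>.\<close>
    then have "real M \<le> sqrt n - 1" using ub by linarith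
    then have Mm: "M \<le> m" unfolding m_def string_length_def by linarith
    have Mn: "real M \<le> n"
    proof -
      have "sqrt n \<le> n" using n by (intro real_le_lsqrt) (auto simp: power2_eq_square)
      with \<open>real M \<le> sqrt n - 1\<close> show ?thesis by linarith
    qed
    \<comment> \<open>Since \<open>M \<le> w * K * L\<close>, one factor \<open>w\<close> cancels,
      and the remaining \<open>w / (K * L)\<close> outgrows log n.\<close>
    have expo: "13 * ln n \<le> 2 * (q * w / 10)\<^sup>2 / M"
    proof -
      have "13 * ln n * M \<le> 13 * ln n * (w * K * L)"
        using M_upper lnn by (intro mult_left_mono) auto
      also have "\<dots> \<le> w * (13 * ln n * ((C * ln n + 1) * L))"
      proof -
        have "13 * ln n * K * L \<le> 13 * ln n * (C * ln n + 1) * L"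
          using K(2) lnn \<open>0 < L\<close> by (intro mult_right_mono mult_left_mono) auto
        then have "w * (13 * ln n * K * L) \<le> w * (13 * ln n * (C * ln n + 1) * L)"
          by (intro mult_left_mono) auto
        then show ?thesis by (simp add: mult_ac)
      qed
      also have "\<dots> \<le> w * (q\<^sup>2 * u / 50)" using lb by (intro mult_left_mono) auto
      also have "\<dots> \<le> w * (q\<^sup>2 * w / 50)" using w(1) by (intro mult_left_mono divide_right_mono) auto
      also have "\<dots> = 2 * (q * w / 10)\<^sup>2" by (simp add: power2_eq_square)
      finally show ?thesis using M0 by (simp add: pos_le_divide_eq)
    qed
    define \<epsilon> where "\<epsilon> = 6 * real M * exp (- 2 * (q * w / 10)\<^sup>2 / M) + exp (- real K / 18)"
    have pow: "exp (- real k * ln n) = 1 / real n ^ k" for k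
      using n by (simp add: exp_minus exp_of_nat_mult inverse_eq_divide)
    \<comment> \<open>The exponent 13 leaves n^(-12) after the union bound over
      \<open>M \<le> n\<close> positions. With \<open>n \<ge> 3\<close> the two terms are at most
      2/3 and 1/3 of \<open>1 / n ^ 10\<close>.\<close>
    have "\<epsilon> \<le> 1 / real n ^ 10"
    proof -
      have "exp (- 2 * (q * w / 10)\<^sup>2 / M) \<le> exp (- real 13 * ln n)" using expo by simp
      also have "\<dots> = 1 / real n ^ 13" by (rule pow)
      finally have "6 * real M * exp (- 2 * (q * w / 10)\<^sup>2 / M) \<le> 6 * n * (1 / real n ^ 13)"
        using Mn by (intro mult_mono) auto
      also have "\<dots> \<le> 2 / 3 * (1 / real n ^ 10)"
      proof -
        have "9 \<le> real n * real n" using mult_mono[OF n n] by simp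
        then show ?thesis using n by (simp add: field_simps eval_nat_numeral)
      qed
      finally have 1: "6 * real M * exp (- 2 * (q * w / 10)\<^sup>2 / M) \<le> 2 / 3 * (1 / real n ^ 10)" .
      have "exp (- real K / 18) \<le> exp (- real 11 * ln n)" using K(1) by simp
      also have "\<dots> = 1 / real n ^ 11" by (rule pow)
      also have "\<dots> \<le> 1 / 3 * (1 / real n ^ 10)" using n by (simp add: field_simps eval_nat_numeral)
      finally show ?thesis unfolding \<epsilon>_def using 1 by linarith
    qed
    note \<epsilon> = this
    note bounds = prob_D_bounds[OF assms qw g Mm M_lower[unfolded K_def], folded K_def, folded \<epsilon>_def]
    show ?case
      unfolding Let_def m_def[symmetric] w_def[symmetric] g_def[symmetric]
      using \<epsilon> by (intro conjI order_trans[OF _ bounds(1)] order_trans[OF _ bounds(2)]) simp_all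
  qed
qed simp

end
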